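(* Let $M$ be the $8$-dimensional compact nilmanifold with $\mathbb{Z}_3$-action, $\widehat{M}=M/\mathbb{Z}_3$, and $\alpha_i,\beta_i,\gamma_i,\eta_i$ ($i=1,2$) the $1$-forms on $M$ described in the context. The $2$-form $\omega$ on $M$ defined by $$\omega=\alpha_1\wedge\alpha_2+\eta_2\wedge\beta_1-\eta_1\wedge\beta_2+\gamma_1\wedge\gamma_2$$ is a $\mathbb{Z}_3$-invariant symplectic form on $M$. Therefore it induces an orbifold $2$-form $\widehat\omega\in\Omega^2_{\mathrm{orb}}(\widehat{M})$ such that $(\widehat{M},\widehat\omega)$ is a symplectic orbifold.
   Context: Let $G=\mathbb{R}^6$ with coordinates $(y_1,y_2,z_1,z_2,v_1,v_2)$ and the nilpotent Lie group multiplication $$(y_1',y_2',z_1',z_2',v_1',v_2')\cdot(y_1,y_2,z_1,z_2,v_1,v_2)=\big(y_1+y_1',\,y_2+y_2',\,z_1+z_1',\,z_2+z_2',\,v_1+v_1'+(y_1'-y_2')z_1-(y_1'+2y_2')z_2,\,v_2+v_2'-(2y_1'+y_2')z_1+(y_2'-y_1')z_2\big).$$ Let $\Gamma=\{(y_1,y_2,z_1,z_2,v_1,v_2)\in\mathbb{Z}^6 : v_1\equiv v_2 \pmod 3\}$, a discrete subgroup of $G$, and let $N=\Gamma\backslash G$ (a compact nilmanifold). Let $T^2=\mathbb{Z}^2\backslash\mathbb{R}^2$ with coordinates $(x_1,x_2)$, and $M=T^2\times N$, a compact $8$-dimensional nilmanifold. The following $1$-forms descend to $M$ and form a basis of the left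 invariant $1$-forms: $\alpha_i=dx_i$, $\beta_i=dy_i$, $\gamma_i=dz_i$ ($i=1,2$), $\eta_1=dv_1-y_1dz_1+y_2dz_1+y_1dz_2+2y_2dz_2$, $\eta_2=dv_2+2y_1dz_1+y_2dz_1+y_1dz_2-y_2dz_2$. The map $$\rho(x_1,x_2,y_1,y_2,z_1,z_2,v_1,v_2)=(-x_1-x_2,\,x_1,\,-y_1-y_2,\,y_1,\,-z_1-z_2,\,z_1,\,-v_1-v_2,\,v_1)$$ is an automorphism of order $3$ of the Lie group $\mathbb{R}^2\times G$ preserving $\mathbb{Z}^2\times\Gamma$, so it induces a diffeomorphism $\rho:M\to M$ generating an action of $\mathbb{Z}_3$ on $M$, which is free away from finitely many fixed points. The quotient $\widehat{M}=M/\mathbb{Z}_3$ is an orbifold; its orbifold differential forms $\Omega^*_{\mathrm{orb}}(\widehat{M})$ are identified with the $\mathbb{Z}_3$-invariant forms on $M$. A symplectic orbifold is an orbifold of even dimension $2n$ with a closed orbifold $2$-form whose $n$-th power is nowhere zero. *)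

theory Defs
  imports "HOL-Analysis.Analysis" "HOL-Algebra.Bij" "HOL-Algebra.Coset" "HOL-Number_Theory.Cong"
begin

section \<open>Smooth maps and differential forms on open subsets of a Euclidean space\<close>

primrec Ck_on :: "nat \<Rightarrow> ('e::euclidean_space \<Rightarrow> 'f::real_normed_vector) \<Rightarrow> 'e set \<Rightarrow> bool" where
  "Ck_on 0 f U \<longleftrightarrow> continuous_on U f"
| "Ck_on (Suc k) f U \<longleftrightarrow>
     f differentiable_on U \<and> (\<forall>v. Ck_on k (\<lambda>x. frechet_derivative f (at x) v) U)"

text \<open>Only used for open \<open>U\<close>, where \<open>at x\<close> and \<open>at x within U\<close> agree.\<close>

definition smooth_on :: "'e::euclidean_space set \<Rightarrow> ('e \<Rightarrow> 'f::real_normed_vector) \<Rightarrow> bool" where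
  "smooth_on U f \<longleftrightarrow> (\<forall>k. Ck_on k f U)"

definition diffeo_on :: "'e::euclidean_space set \<Rightarrow> 'e set \<Rightarrow> ('e \<Rightarrow> 'e) \<Rightarrow> bool" where
  "diffeo_on U V f \<longleftrightarrow> open U \<and> open V \<and> bij_betw f U V \<and>
     smooth_on U f \<and> smooth_on V (inv_into U f)"

text \<open>A \<open>k\<close>-form assigns to a point \<open>x\<close> and a list of \<open>k\<close> tangent vectors a real number;
  the values on lists of any other length are irrelevant.\<close>

type_synonym 'e form = "'e \<Rightarrow> 'e list \<Rightarrow> real"

definition alternating_multilinear :: "nat \<Rightarrow> ('e::euclidean_space list \<Rightarrow> real) \<Rightarrow> bool" where
  "alternating_multilinear k a \<longleftrightarrow> (\<forall>vs. length vs = k \<longrightarrow>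
     (\<forall>i<k. linear (\<lambda>v. a (vs[i := v]))) \<and>
     (\<forall>i<k. \<forall>j<k. i \<noteq> j \<and> vs ! i = vs ! j \<longrightarrow> a vs = 0))"

definition smooth_form :: "nat \<Rightarrow> 'e::euclidean_space set \<Rightarrow> 'e form \<Rightarrow> bool" where
  "smooth_form k U \<theta> \<longleftrightarrow>
     (\<forall>x\<in>U. alternating_multilinear k (\<theta> x)) \<and>
     (\<forall>vs. length vs = k \<longrightarrow> smooth_on U (\<lambda>x. \<theta> x vs))"

definition ext_deriv :: "nat \<Rightarrow> 'e::euclidean_space form \<Rightarrow> 'e form" where
  "ext_deriv k \<theta> x vs = (\<Sum>i\<le>k. (-1) ^ i *
     frechet_derivative (\<lambda>y. \<theta> y (take i vs @ drop (Suc i) vs)) (at x) (vs ! i))"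

text \<open>The shuffle formula, normalised so that
  \<open>(a \<and> b)(u, v) = a(u) b(v) - a(v) b(u)\<close> for 1-forms. A shuffle is given by the set \<open>I\<close>
  of the positions of the arguments fed to the first factor.\<close>

definition shuffle_sign :: "nat \<Rightarrow> nat set \<Rightarrow> real" where
  "shuffle_sign n I = (-1) ^ card {(i, j). i \<in> I \<and> j \<in> {..<n} - I \<and> j < i}"

definition wedge :: "nat \<Rightarrow> nat \<Rightarrow> 'e form \<Rightarrow> 'e form \<Rightarrow> 'e form" where
  "wedge k l \<theta> \<eta> x vs = (\<Sum>I | I \<subseteq> {..<k + l} \<and> card I = k.
     shuffle_sign (k + l) I * \<theta> x (nths vs I) * \<eta> x (nths vs ({..<k + l} - I)))"

abbreviation wedge11 :: "'e form \<Rightarrow> 'e form \<Rightarrow> 'e form" (infixl \<open>\<and>\<^sub>1\<close> 70) where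
  "\<theta> \<and>\<^sub>1 \<eta> \<equiv> wedge 1 1 \<theta> \<eta>"

text \<open>The wedge powers of a 2-form.\<close>

primrec wedge_power :: "'e form \<Rightarrow> nat \<Rightarrow> 'e form" where
  "wedge_power \<theta> 0 = (\<lambda>x vs. 1)"
| "wedge_power \<theta> (Suc n) = wedge 2 (2 * n) \<theta> (wedge_power \<theta> n)"

definition pullback :: "('e::euclidean_space \<Rightarrow> 'f::euclidean_space) \<Rightarrow> 'f form \<Rightarrow> 'e form" where
  "pullback f \<theta> x vs = \<theta> (f x) (map (frechet_derivative f (at x)) vs)"


section \<open>Orbifolds, manifolds and their differential forms\<close>

text \<open>A chart \<open>(U, H, \<phi>)\<close> consists of a connected open set \<open>U\<close>, a finite group \<open>H\<close> of
  diffeomorphisms of \<open>U\<close> and a map \<open>\<phi>\<close> inducing a homeomorphism from \<open>U/H\<close> onto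
  an open subset of the underlying space. Only the values of \<open>\<phi>\<close> on \<open>U\<close> matter.\<close>

type_synonym ('e, 'a) chart = "'e set \<times> ('e \<Rightarrow> 'e) set \<times> ('e \<Rightarrow> 'a)"

definition orbifold_chart :: "'a topology \<Rightarrow> ('e::euclidean_space, 'a) chart \<Rightarrow> bool" where
  "orbifold_chart X = (\<lambda>(U, H, \<phi>).
     open U \<and> connected U \<and> U \<noteq> {} \<and>
     finite H \<and> subgroup H (BijGroup U) \<and> (\<forall>h\<in>H. smooth_on U h) \<and>
     openin X (\<phi> ` U) \<and>
     quotient_map (top_of_set U) (subtopology X (\<phi> ` U)) \<phi> \<and>
     (\<forall>x\<in>U. \<forall>y\<in>U. \<phi> x = \<phi> y \<longleftrightarrow> (\<exists>h\<in>H. h x = y)))"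

definition charts_compatible ::
    "('e::euclidean_space, 'a) chart \<Rightarrow> ('e, 'a) chart \<Rightarrow> bool" where
  "charts_compatible = (\<lambda>(U, H, \<phi>) (V, K, \<psi>).
     \<forall>x\<in>U. \<forall>y\<in>V. \<phi> x = \<psi> y \<longrightarrow>
       (\<exists>W W' \<tau>. x \<in> W \<and> W \<subseteq> U \<and> W' \<subseteq> V \<and> diffeo_on W W' \<tau> \<and> \<tau> x = y \<and>
          (\<forall>w\<in>W. \<psi> (\<tau> w) = \<phi> w)))"

definition orbifold :: "'a topology \<Rightarrow> ('e::euclidean_space, 'a) chart set \<Rightarrow> bool" where
  "orbifold X A \<longleftrightarrow>
     Hausdorff_space X \<and> second_countable X \<and>
     (\<forall>c\<in>A. orbifold_chart X c) \<and>
     (\<Union>(U, H, \<phi>)\<in>A. \<phi> ` U) = topspace X \<and>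
     (\<forall>c\<in>A. \<forall>d\<in>A. charts_compatible c d)"

text \<open>A manifold is an orbifold all of whose chart groups are trivial, so that the charts are
  injective; the maps \<open>\<phi>\<close> are local parametrisations.\<close>

definition smooth_manifold :: "'a topology \<Rightarrow> ('e::euclidean_space, 'a) chart set \<Rightarrow> bool" where
  "smooth_manifold X A \<longleftrightarrow> orbifold X A \<and> (\<forall>(U, H, \<phi>)\<in>A. H = {\<lambda>x\<in>U. x})"

definition local_lift ::
    "('a \<Rightarrow> 'b) \<Rightarrow> ('e::euclidean_space, 'a) chart \<Rightarrow> ('f::euclidean_space, 'b) chart \<Rightarrow>
     'e set \<Rightarrow> ('e \<Rightarrow> 'f) \<Rightarrow> bool" where
  "local_lift f = (\<lambda>(U, H, \<phi>) (V, K, \<psi>) W \<tau>.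
     open W \<and> W \<subseteq> U \<and> smooth_on W \<tau> \<and> \<tau> ` W \<subseteq> V \<and> (\<forall>w\<in>W. \<psi> (\<tau> w) = f (\<phi> w)))"

definition smooth_map ::
    "('a \<Rightarrow> 'b) \<Rightarrow> ('e::euclidean_space, 'a) chart set \<Rightarrow> ('f::euclidean_space, 'b) chart set \<Rightarrow> bool" where
  "smooth_map f A B \<longleftrightarrow>
     (\<forall>c\<in>A. \<forall>x\<in>fst c. \<exists>d\<in>B. \<exists>W \<tau>. x \<in> W \<and> local_lift f c d W \<tau>)"

text \<open>A form on an orbifold is a family of forms indexed by the charts.
  \<open>is_pullback f A B k \<theta> \<eta>\<close> says that \<open>f\<close> is smooth and that the \<open>k\<close>-form \<open>\<eta>\<close> on the source
  is the pullback of the \<open>k\<close>-form \<open>\<theta>\<close> on the target, as seen through every local lift of \<open>f\<close>.\<close>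

type_synonym ('e, 'a) orbi_form = "('e, 'a) chart \<Rightarrow> 'e form"

definition is_pullback ::
    "('a \<Rightarrow> 'b) \<Rightarrow> ('e::euclidean_space, 'a) chart set \<Rightarrow> ('f::euclidean_space, 'b) chart set \<Rightarrow>
     nat \<Rightarrow> ('f, 'b) orbi_form \<Rightarrow> ('e, 'a) orbi_form \<Rightarrow> bool" where
  "is_pullback f A B k \<theta> \<eta> \<longleftrightarrow>
     smooth_map f A B \<and>
     (\<forall>c\<in>A. \<forall>d\<in>B. \<forall>W \<tau>. local_lift f c d W \<tau> \<longrightarrow>
        (\<forall>x\<in>W. \<forall>vs. length vs = k \<longrightarrow> pullback \<tau> (\<theta> d) x vs = \<eta> c x vs))"

text \<open>Being the pullback of itself under the identity expresses both the compatibility with all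
  changes of charts and the invariance under the chart groups.\<close>

definition orbifold_form ::
    "nat \<Rightarrow> ('e::euclidean_space, 'a) chart set \<Rightarrow> ('e, 'a) orbi_form \<Rightarrow> bool" where
  "orbifold_form k A \<theta> \<longleftrightarrow>
     (\<forall>c\<in>A. smooth_form k (fst c) (\<theta> c)) \<and> is_pullback id A A k \<theta> \<theta>"

definition closed_form ::
    "nat \<Rightarrow> ('e::euclidean_space, 'a) chart set \<Rightarrow> ('e, 'a) orbi_form \<Rightarrow> bool" where
  "closed_form k A \<theta> \<longleftrightarrow>
     (\<forall>c\<in>A. \<forall>x\<in>fst c. \<forall>vs. length vs = Suc k \<longrightarrow> ext_deriv k (\<theta> c) x vs = 0)"

definition symplectic_form ::
    "('e::euclidean_space, 'a) chart set \<Rightarrow> ('e, 'a) orbi_form \<Rightarrow> bool" where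
  "symplectic_form A \<omega> \<longleftrightarrow>
     orbifold_form 2 A \<omega> \<and> closed_form 2 A \<omega> \<and>
     (\<exists>n. DIM('e) = 2 * n \<and>
        (\<forall>c\<in>A. \<forall>x\<in>fst c. \<exists>vs. length vs = 2 * n \<and> wedge_power (\<omega> c) n x vs \<noteq> 0))"

definition symplectic_manifold ::
    "'a topology \<Rightarrow> ('e::euclidean_space, 'a) chart set \<Rightarrow> ('e, 'a) orbi_form \<Rightarrow> bool" where
  "symplectic_manifold X A \<omega> \<longleftrightarrow> smooth_manifold X A \<and> symplectic_form A \<omega>"

definition symplectic_orbifold ::
    "'a topology \<Rightarrow> ('e::euclidean_space, 'a) chart set \<Rightarrow> ('e, 'a) orbi_form \<Rightarrow> bool" where
  "symplectic_orbifold X A \<omega> \<longleftrightarrow> orbifold X A \<and> symplectic_form A \<omega>"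


section \<open>Quotient topologies\<close>

definition quotient_topology :: "'a topology \<Rightarrow> ('a \<Rightarrow> 'b) \<Rightarrow> 'b topology" where
  "quotient_topology X q =
     topology (\<lambda>V. V \<subseteq> q ` topspace X \<and> openin X {x \<in> topspace X. q x \<in> V})"

lemma openin_quotient_topology:
  "openin (quotient_topology X q) V \<longleftrightarrow>
     V \<subseteq> q ` topspace X \<and> openin X {x \<in> topspace X. q x \<in> V}"
proof -
  have "istopology (\<lambda>V. V \<subseteq> q ` topspace X \<and> openin X {x \<in> topspace X. q x \<in> V})"
    unfolding istopology_def
  proof (intro conjI allI impI; (elim conjE)?)
    fix S T
    assume "openin X {x \<in> topspace X. q x \<in> S}" "openin X {x \<in> topspace X. q x \<in> T}"
    then have "openin X ({x \<in> topspace X. q x \<in> S} \<inter> {x \<in> topspace X. q x \<in> T})"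
      by blast
    moreover have "{x \<in> topspace X. q x \<in> S} \<inter> {x \<in> topspace X. q x \<in> T} =
        {x \<in> topspace X. q x \<in> S \<inter> T}"
      by blast
    ultimately show "openin X {x \<in> topspace X. q x \<in> S \<inter> T}"
      by simp
  next
    fix \<K> assume *: "\<forall>K\<in>\<K>. K \<subseteq> q ` topspace X \<and> openin X {x \<in> topspace X. q x \<in> K}"
    then show "\<Union>\<K> \<subseteq> q ` topspace X" by blast
    have "openin X (\<Union>K\<in>\<K>. {x \<in> topspace X. q x \<in> K})"
      using * by blast
    moreover have "(\<Union>K\<in>\<K>. {x \<in> topspace X. q x \<in> K}) = {x \<in> topspace X. q x \<in> \<Union>\<K>}"
      by blast
    ultimately show "openin X {x \<in> topspace X. q x \<in> \<Union>\<K>}"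
      by simp
  qed auto
  then show ?thesis
    by (simp add: quotient_topology_def topology_inverse')
qed

lemma quotient_map_quotient_topology: "quotient_map X (quotient_topology X q) q"
proof -
  have "topspace (quotient_topology X q) = q ` topspace X"
  proof
    show "topspace (quotient_topology X q) \<subseteq> q ` topspace X"
      using openin_topspace[of "quotient_topology X q"] unfolding openin_quotient_topology by blast
    have "{x \<in> topspace X. q x \<in> q ` topspace X} = topspace X" by blast
    then have "openin (quotient_topology X q) (q ` topspace X)"
      by (simp add: openin_quotient_topology)
    then show "q ` topspace X \<subseteq> topspace (quotient_topology X q)"
      by (rule openin_subset)
  qed
  then show ?thesis
    unfolding quotient_map_def openin_quotient_topology by auto
qed


section \<open>The nilmanifold and its quotient\<close>

type_synonym r2 = "real \<times> real"
type_synonym r6 = "real \<times> real \<times> real \<times> real \<times> real \<times> real"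

definition R2 :: "r2 monoid" where
  "R2 = \<lparr>carrier = UNIV, mult = (+), one = 0\<rparr>"

fun G_mult :: "r6 \<Rightarrow> r6 \<Rightarrow> r6" where
  "G_mult (y1', y2', z1', z2', v1', v2') (y1, y2, z1, z2, v1, v2) =
     (y1 + y1', y2 + y2', z1 + z1', z2 + z2',
      v1 + v1' + (y1' - y2') * z1 - (y1' + 2 * y2') * z2,
      v2 + v2' - (2 * y1' + y2') * z1 + (y2' - y1') * z2)"

definition G :: "r6 monoid" where
  "G = \<lparr>carrier = UNIV, mult = G_mult, one = 0\<rparr>"

definition Z2 :: "r2 set" where
  "Z2 = {(of_int a, of_int b) | a b :: int. True}"

definition \<Gamma> :: "r6 set" where
  "\<Gamma> = {(of_int a1, of_int a2, of_int b1, of_int b2, of_int c1, of_int c2) |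
          a1 a2 b1 b2 c1 c2 :: int. [c1 = c2] (mod 3)}"

lemma group_R2: "group R2"
proof (rule groupI)
  fix x assume "x \<in> carrier R2"
  show "\<exists>y\<in>carrier R2. y \<otimes>\<^bsub>R2\<^esub> x = \<one>\<^bsub>R2\<^esub>"
    by (rule bexI[of _ "- x"]) (auto simp: R2_def)
qed (auto simp: R2_def add.assoc)

lemma group_G: "group G"
proof (rule groupI)
  fix x assume "x \<in> carrier G"
  obtain y1 y2 z1 z2 v1 v2 where x: "x = (y1, y2, z1, z2, v1, v2)"
    using prod_cases6 by blast
  show "\<exists>y\<in>carrier G. y \<otimes>\<^bsub>G\<^esub> x = \<one>\<^bsub>G\<^esub>"
    by (rule bexI[of _ "(- y1, - y2, - z1, - z2,
          - v1 + (y1 - y2) * z1 - (y1 + 2 * y2) * z2,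
          - v2 - (2 * y1 + y2) * z1 + (y2 - y1) * z2)"])
       (auto simp: G_def x zero_prod_def algebra_simps)
qed (auto simp: G_def zero_prod_def algebra_simps)

text \<open>The quotients are spaces of cosets \<open>\<Gamma> g\<close>, that is, quotients by left multiplication. The points
  of \<open>M\<close> are pairs of cosets.\<close>

type_synonym M_point = "r2 set \<times> r6 set"

definition T2_top :: "r2 set topology" where
  "T2_top = quotient_topology euclidean (\<lambda>x. Z2 #>\<^bsub>R2\<^esub> x)"

definition N_top :: "r6 set topology" where
  "N_top = quotient_topology euclidean (\<lambda>g. \<Gamma> #>\<^bsub>G\<^esub> g)"

definition M_top :: "M_point topology" where
  "M_top = prod_topology T2_top N_top"

definition proj_M :: "r2 \<times> r6 \<Rightarrow> M_point" where
  "proj_M = map_prod (\<lambda>x. Z2 #>\<^bsub>R2\<^esub> x) (\<lambda>g. \<Gamma> #>\<^bsub>G\<^esub> g)"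

text \<open>The charts of \<open>M\<close> are the restrictions of the covering map \<open>proj_M\<close> to connected open sets
  on which it is a homeomorphism onto an open set.\<close>

definition M_atlas :: "(r2 \<times> r6, M_point) chart set" where
  "M_atlas = {(U, H, \<phi>). \<phi> = proj_M \<and> H = {\<lambda>x\<in>U. x} \<and> orbifold_chart M_top (U, H, \<phi>)}"

fun rho_T :: "r2 \<Rightarrow> r2" where
  "rho_T (x1, x2) = (- x1 - x2, x1)"

fun rho_N :: "r6 \<Rightarrow> r6" where
  "rho_N (y1, y2, z1, z2, v1, v2) = (- y1 - y2, y1, - z1 - z2, z1, - v1 - v2, v1)"

text \<open>An automorphism preserving the lattice maps cosets to cosets, so the induced map on cosets is
  the image map.\<close>

definition rho_M :: "M_point \<Rightarrow> M_point" where
  "rho_M = map_prod ((`) rho_T) ((`) rho_N)"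

text \<open>The points of the quotient of \<open>M\<close> by the action of the cyclic group generated by \<open>rho_M\<close>
  are the orbits.\<close>

definition proj_Mhat :: "M_point \<Rightarrow> M_point set" where
  "proj_Mhat m = {(rho_M ^^ j) m | j. True}"

definition Mhat_top :: "M_point set topology" where
  "Mhat_top = quotient_topology M_top proj_Mhat"

text \<open>The orbifold structure induced by the smooth structure of \<open>M\<close>: all charts for which the
  chart map is the restriction of the composed projection \<open>\<real>\<^sup>2 \<times> G \<rightarrow> M \<rightarrow> M/\<int>\<^sub>3\<close>.\<close>

definition Mhat_atlas :: "(r2 \<times> r6, M_point set) chart set" where
  "Mhat_atlas = {(U, H, \<phi>). \<phi> = proj_Mhat \<circ> proj_M \<and> orbifold_chart Mhat_top (U, H, \<phi>)}"


section \<open>The invariant forms\<close>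

fun crd_x1 crd_x2 crd_y1 crd_y2 crd_z1 crd_z2 crd_v1 crd_v2 :: "r2 \<times> r6 \<Rightarrow> real" where
  "crd_x1 ((x1, x2), (y1, y2, z1, z2, v1, v2)) = x1"
| "crd_x2 ((x1, x2), (y1, y2, z1, z2, v1, v2)) = x2"
| "crd_y1 ((x1, x2), (y1, y2, z1, z2, v1, v2)) = y1"
| "crd_y2 ((x1, x2), (y1, y2, z1, z2, v1, v2)) = y2"
| "crd_z1 ((x1, x2), (y1, y2, z1, z2, v1, v2)) = z1"
| "crd_z2 ((x1, x2), (y1, y2, z1, z2, v1, v2)) = z2"
| "crd_v1 ((x1, x2), (y1, y2, z1, z2, v1, v2)) = v1"
| "crd_v2 ((x1, x2), (y1, y2, z1, z2, v1, v2)) = v2"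

definition df :: "('e::euclidean_space \<Rightarrow> real) \<Rightarrow> 'e form" where
  "df f = ext_deriv 0 (\<lambda>x vs. f x)"

definition "\<alpha>\<^sub>1 = df crd_x1"
definition "\<alpha>\<^sub>2 = df crd_x2"
definition "\<beta>\<^sub>1 = df crd_y1"
definition "\<beta>\<^sub>2 = df crd_y2"
definition "\<gamma>\<^sub>1 = df crd_z1"
definition "\<gamma>\<^sub>2 = df crd_z2"

definition \<eta>\<^sub>1 :: "(r2 \<times> r6) form" where
  "\<eta>\<^sub>1 p vs = df crd_v1 p vs - crd_y1 p * df crd_z1 p vs + crd_y2 p * df crd_z1 p vs
     + crd_y1 p * df crd_z2 p vs + 2 * crd_y2 p * df crd_z2 p vs"

definition \<eta>\<^sub>2 :: "(r2 \<times> r6) form" where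
  "\<eta>\<^sub>2 p vs = df crd_v2 p vs + 2 * crd_y1 p * df crd_z1 p vs + crd_y2 p * df crd_z1 p vs
     + crd_y1 p * df crd_z2 p vs - crd_y2 p * df crd_z2 p vs"

definition \<omega> :: "(r2 \<times> r6) form" where
  "\<omega> p vs = (\<alpha>\<^sub>1 \<and>\<^sub>1 \<alpha>\<^sub>2) p vs + (\<eta>\<^sub>2 \<and>\<^sub>1 \<beta>\<^sub>1) p vs - (\<eta>\<^sub>1 \<and>\<^sub>1 \<beta>\<^sub>2) p vs + (\<gamma>\<^sub>1 \<and>\<^sub>1 \<gamma>\<^sub>2) p vs"

text \<open>The form on \<open>M\<close> to which \<open>\<omega>\<close> descends. As every chart of \<open>M\<close> is a restriction of the
  covering map, its expression in each chart is \<open>\<omega>\<close> itself; that it is well defined is the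
  compatibility condition in \<open>orbifold_form 2 M_atlas \<omega>_M\<close>.\<close>

definition \<omega>_M :: "(r2 \<times> r6, M_point) orbi_form" where
  "\<omega>_M = (\<lambda>c. \<omega>)"

definition Z3_invariant :: "nat \<Rightarrow> (r2 \<times> r6, M_point) orbi_form \<Rightarrow> bool" where
  "Z3_invariant k \<theta> \<longleftrightarrow> is_pullback rho_M M_atlas M_atlas k \<theta> \<theta>"

end

theory Submission
  imports Defs
begin

text \<open>
  Both \<open>M\<close> and \<open>M/\<int>\<^sub>3\<close> are quotients of \<open>\<real>\<^sup>2 \<times> G\<close>, that is of \<open>\<real>\<^sup>8\<close>: the first by left translations
  with the lattice \<open>\<int>\<^sup>2 \<times> \<Gamma>\<close>, the second by the larger group \<open>deck\<close> generated by these translations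
  and the automorphism \<open>rho\<close> of order 3. All claims follow from two facts: these groups act properly
  discontinuously by affine maps, and \<open>\<omega>\<close> is a closed, nondegenerate 2-form on \<open>\<real>\<^sup>8\<close> that is invariant
  under \<open>deck\<close>. The induced form on either quotient is then \<open>\<omega>\<close> itself, read in every chart.

  The general part is the locale \<open>discrete_smooth_action\<close>. A properly discontinuous action has
  Hausdorff, second countable quotient, and around each point there is a connected neighbourhood
  invariant under the finite stabilizer and moved off itself by all other group elements
  (lemma \<open>slice\<close>); restricting the projection to it gives an orbifold chart. Charts are compatible
  because two lifts of a point differ by a group element. If the action is free, the chart groups are
  trivial and the quotient is a manifold.

  The delicate point is that forms on orbifolds are tested against all local lifts of a map. A smooth
  \<open>\<tau>\<close> with \<open>\<tau> w\<close> in the orbit of \<open>w\<close> for each \<open>w\<close> need not be given a priori by a single group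
  element near a singular point. By Baire's theorem it is so on a dense open set, and the equation
  \<open>\<tau>\<^sup>* \<omega> = \<omega>\<close> extends from there by continuity (lemma \<open>pullback_along_orbits\<close>). One lemma,
  \<open>is_pullback_of_lift\<close>, then gives the compatibility of \<open>\<omega>\<close> with the charts of \<open>M\<close> and of \<open>M/\<int>\<^sub>3\<close>,
  the \<open>\<int>\<^sub>3\<close>-invariance on \<open>M\<close>, and the fact that the projection of \<open>M\<close> onto the quotient pulls the
  induced form back to the given one.

  For \<open>\<omega>\<close> itself, the forms \<open>\<alpha>\<^sub>i, \<beta>\<^sub>i, \<gamma>\<^sub>i, \<eta>\<^sub>i\<close> are left invariant, and \<open>rho\<close> acts on each of the four
  pairs by the same matrix of determinant 1, under which \<open>\<omega>\<close> is invariant. Closedness is the relation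
  \<open>d\<eta>\<^sub>2 \<and> \<beta>\<^sub>1 = d\<eta>\<^sub>1 \<and> \<beta>\<^sub>2\<close>. On the frame dual to these forms \<open>\<omega>\<close> is the standard symplectic form,
  so its fourth power takes the value \<open>4!\<close>.
\<close>

section \<open>Smooth maps and pullbacks of forms\<close>

lemma Ck_on_const: "Ck_on k (\<lambda>x. c) U"
  by (induction k arbitrary: c) auto

lemma Ck_on_subset: "Ck_on k f U \<Longrightarrow> V \<subseteq> U \<Longrightarrow> Ck_on k f V"
  by (induction k arbitrary: f) (auto intro: continuous_on_subset differentiable_on_subset)

text \<open>Openness is essential: the derivative in \<open>Ck_on\<close> is the unrestricted one, so it sees only the
  germ of a function at a point.\<close>

lemma Ck_on_cong:
  assumes "open U" "\<And>x. x \<in> U \<Longrightarrow> f x = g x" "Ck_on k f U"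
  shows "Ck_on k g U"
  using assms(2,3)
proof (induction k arbitrary: f g)
  case 0
  then show ?case by (metis Ck_on.simps(1) continuous_on_cong)
next
  case (Suc k)
  have diff: "f differentiable_on U" and Ck: "\<And>v. Ck_on k (\<lambda>x. frechet_derivative f (at x) v) U"
    using Suc.prems by auto
  have "g differentiable_on U"
    using diff Suc.prems(1)
    by (metis differentiable_transform_within differentiable_on_def zero_less_one)
  moreover have "frechet_derivative f (at x) = frechet_derivative g (at x)" if "x \<in> U" for x
    using frechet_derivative_transform_within_open[of f x U g] diff that assms(1) Suc.prems(1)
    by (simp add: differentiable_on_eq_differentiable_at)
  then have "Ck_on k (\<lambda>x. frechet_derivative g (at x) v) U" for v
    using Suc.IH[OF _ Ck[of v]] by simp
  ultimately show ?case by simp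
qed

lemma smooth_on_subset: "smooth_on U f \<Longrightarrow> V \<subseteq> U \<Longrightarrow> smooth_on V f"
  by (auto simp: smooth_on_def intro: Ck_on_subset)

lemma smooth_on_cong:
  "open U \<Longrightarrow> (\<And>x. x \<in> U \<Longrightarrow> f x = g x) \<Longrightarrow> smooth_on U f \<Longrightarrow> smooth_on U g"
  by (auto simp: smooth_on_def intro: Ck_on_cong)

lemma smooth_on_imp_continuous_on: "smooth_on U f \<Longrightarrow> continuous_on U f"
  unfolding smooth_on_def by (metis Ck_on.simps(1))

lemma smooth_on_imp_differentiable:
  assumes "smooth_on U f" "open U" "x \<in> U"
  shows "f differentiable at x"
proof -
  have "Ck_on (Suc 0) f U" using assms(1) unfolding smooth_on_def by blast
  then show ?thesis using assms by (simp add: differentiable_on_eq_differentiable_at)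
qed

lemma smooth_on_imp_continuous_derivative:
  assumes "smooth_on U f"
  shows "continuous_on U (\<lambda>x. frechet_derivative f (at x) v)"
proof -
  have "Ck_on (Suc 0) f U" using assms unfolding smooth_on_def by blast
  then show ?thesis by simp
qed

lemma has_derivative_affine:
  assumes "bounded_linear A" shows "((\<lambda>x. A x + c) has_derivative A) (at x)"
  using has_derivative_add[OF bounded_linear_imp_has_derivative[OF assms] has_derivative_const]
  by simp

lemma frechet_derivative_affine:
  assumes "bounded_linear A" shows "frechet_derivative (\<lambda>x. A x + c) (at x) = A"
  using frechet_derivative_at[OF has_derivative_affine[OF assms]] by simp

text \<open>Left translations of a two-step nilpotent group, the automorphism \<open>rho\<close> and the coefficients of
  \<open>\<omega>\<close> are all affine in the coordinates, so this is all the smoothness that the concrete objects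
  require.\<close>

lemma smooth_on_affine:
  assumes "bounded_linear A" shows "smooth_on U (\<lambda>x. A x + c)"
  unfolding smooth_on_def
proof
  fix k show "Ck_on k (\<lambda>x. A x + c) U"
  proof (cases k)
    case 0
    then show ?thesis
      using linear_continuous_on[OF assms] by (auto intro!: continuous_intros)
  next
    case (Suc j)
    have "(\<lambda>x. A x + c) differentiable_on U"
      using has_derivative_affine[OF assms]
      by (meson differentiable_at_imp_differentiable_on differentiable_def)
    then show ?thesis
      using Suc by (simp add: frechet_derivative_affine[OF assms] Ck_on_const)
  qed
qed

text \<open>Continuity of a form is only known on constant arguments. Expanding the moving arguments one at a
  time in the standard basis reduces to that case; the induction lets a suffix \<open>us\<close> of arguments
  be constant already.\<close>

lemma continuous_on_form_along:
  assumes "\<And>x. x \<in> W \<Longrightarrow> alternating_multilinear k (\<Theta> x)"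
    and "\<And>vs. length vs = k \<Longrightarrow> continuous_on W (\<lambda>x. \<Theta> x vs)"
    and "\<And>f. f \<in> set fs \<Longrightarrow> continuous_on W f" "length fs + length us = k"
  shows "continuous_on W (\<lambda>x. \<Theta> x (map (\<lambda>f. f x) fs @ us))"
  using assms(3,4)
proof (induction fs arbitrary: us rule: rev_induct)
  case Nil
  then show ?case using assms(2) by simp
next
  case (snoc f fs)
  have "\<Theta> x (map (\<lambda>f. f x) fs @ f x # us) =
      (\<Sum>b\<in>Basis. (f x \<bullet> b) * \<Theta> x (map (\<lambda>f. f x) fs @ b # us))" if "x \<in> W" for x
  proof -
    have "linear (\<lambda>v. \<Theta> x ((map (\<lambda>f. f x) fs @ 0 # us)[length fs := v]))"
      using assms(1)[OF that] snoc.prems(2) unfolding alternating_multilinear_def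
      by (auto dest!: spec[of _ "map (\<lambda>f. f x) fs @ 0 # us"])
    then have lin: "linear (\<lambda>v. \<Theta> x (map (\<lambda>f. f x) fs @ v # us))"
      by (simp add: list_update_append)
    have "\<Theta> x (map (\<lambda>f. f x) fs @ (\<Sum>b\<in>Basis. (f x \<bullet> b) *\<^sub>R b) # us) =
      (\<Sum>b\<in>Basis. (f x \<bullet> b) * \<Theta> x (map (\<lambda>f. f x) fs @ b # us))"
      using linear_sum[OF lin, of "\<lambda>b. (f x \<bullet> b) *\<^sub>R b" Basis]
      by (simp add: linear_cmul[OF lin])
    then show ?thesis by (simp add: euclidean_representation)
  qed
  moreover have "continuous_on W (\<lambda>x. \<Sum>b\<in>Basis. (f x \<bullet> b) * \<Theta> x (map (\<lambda>f. f x) fs @ b # us))"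
    using snoc by (intro continuous_intros) auto
  ultimately show ?case by simp
qed

lemma continuous_on_pullback:
  assumes "smooth_form k UNIV \<theta>" "smooth_on W \<tau>" "length vs = k"
  shows "continuous_on W (\<lambda>x. pullback \<tau> \<theta> x vs)"
proof -
  have "continuous_on W (\<lambda>x. \<theta> (\<tau> x) us)" if "length us = k" for us
  proof (rule continuous_on_compose2[of UNIV "\<lambda>y. \<theta> y us"])
    show "continuous_on UNIV (\<lambda>y. \<theta> y us)"
      using assms(1) that unfolding smooth_form_def by (blast intro: smooth_on_imp_continuous_on)
  qed (use smooth_on_imp_continuous_on[OF assms(2)] in auto)
  note cont = this
  have "continuous_on W (\<lambda>x. \<theta> (\<tau> x)
      (map (\<lambda>f. f x) (map (\<lambda>v x. frechet_derivative \<tau> (at x) v) vs) @ []))"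
  proof (intro continuous_on_form_along[where k = k and \<Theta> = "\<lambda>x. \<theta> (\<tau> x)"])
    show "alternating_multilinear k (\<theta> (\<tau> x))" for x
      using assms(1) by (simp add: smooth_form_def)
    show "continuous_on W f" if "f \<in> set (map (\<lambda>v x. frechet_derivative \<tau> (at x) v) vs)" for f
      using that smooth_on_imp_continuous_derivative[OF assms(2)] by auto
    show "length (map (\<lambda>v x. frechet_derivative \<tau> (at x) v) vs) + length [] = k"
      using assms(3) by simp
  qed (rule cont)
  then show ?thesis by (simp add: pullback_def comp_def)
qed

lemma pullback_compose:
  assumes "g differentiable at x" "f differentiable at (g x)"
  shows "pullback (f \<circ> g) \<theta> x vs = pullback g (pullback f \<theta>) x vs"
  by (simp add: pullback_def frechet_derivative_compose[OF assms])

definition affine_map :: "('a::real_normed_vector \<Rightarrow> 'b::real_normed_vector) \<Rightarrow> bool" where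
  "affine_map f \<longleftrightarrow> (\<exists>A c. bounded_linear A \<and> f = (\<lambda>x. A x + c))"

lemma affine_map_compose:
  assumes "affine_map f" "affine_map g" shows "affine_map (f \<circ> g)"
proof -
  obtain A c B d where A: "bounded_linear A" "f = (\<lambda>x. A x + c)"
    and B: "bounded_linear B" "g = (\<lambda>x. B x + d)"
    using assms unfolding affine_map_def by blast
  have "f \<circ> g = (\<lambda>x. A (B x) + (A d + c))"
    using A B by (auto simp: fun_eq_iff linear_add bounded_linear.linear)
  then show ?thesis
    unfolding affine_map_def using bounded_linear_compose[OF A(1) B(1)] by blast
qed

lemma affine_map_funpow:
  fixes f :: "'a::real_normed_vector \<Rightarrow> 'a"
  shows "affine_map f \<Longrightarrow> affine_map (f ^^ j)"
proof (induction j)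
  case 0
  have "bounded_linear (\<lambda>x. x) \<and> f ^^ 0 = (\<lambda>x. x + 0)" by (simp add: fun_eq_iff bounded_linear_ident)
  then show ?case unfolding affine_map_def by blast
qed (simp add: affine_map_compose)

lemma smooth_on_affine_map: "affine_map f \<Longrightarrow> smooth_on U f" for f :: "'a::euclidean_space \<Rightarrow> 'b::real_normed_vector"
  unfolding affine_map_def using smooth_on_affine by blast

lemma differentiable_affine_map: "affine_map f \<Longrightarrow> f differentiable at x"
  unfolding affine_map_def differentiable_def using has_derivative_affine by blast

lemma pullback_compose_invariant:
  assumes "\<And>x vs. length vs = k \<Longrightarrow> pullback f \<theta> x vs = \<theta> x vs"
    and "\<And>x vs. length vs = k \<Longrightarrow> pullback g \<theta> x vs = \<theta> x vs"
    and "affine_map f" "affine_map g" "length vs = k"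
  shows "pullback (f \<circ> g) \<theta> x vs = \<theta> x vs"
proof -
  have "pullback (f \<circ> g) \<theta> x vs = pullback g (pullback f \<theta>) x vs"
    using assms by (intro pullback_compose differentiable_affine_map)
  also have "\<dots> = pullback g \<theta> x vs" unfolding pullback_def[of g] using assms by simp
  finally show ?thesis using assms by simp
qed

section \<open>Wedge powers on a symplectic frame\<close>

lemma nths_eq_map_filter: "nths xs A = map ((!) xs) (filter (\<lambda>i. i \<in> A) [0..<length xs])"
proof (induction xs rule: rev_induct)
  case (snoc x xs)
  have "map ((!) (xs @ [x])) (filter (\<lambda>i. i \<in> A) [0..<length xs]) =
        map ((!) xs) (filter (\<lambda>i. i \<in> A) [0..<length xs])"
    by (auto simp: nth_append)
  then show ?case using snoc by (simp add: nths_append)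
qed simp

lemma upt_split_at_pair:
  assumes "i < j" "j < m"
  shows "[0..<m] = [0..<i] @ i # [Suc i..<j] @ j # [Suc j..<m]"
  using assms by (metis less_imp_add_positive less_trans upt_conv_Cons upt_add_eq_append zero_le less_imp_le Suc_leI)

lemma nths_pair:
  assumes "i < j" "j < length xs"
  shows "nths xs {i, j} = [xs ! i, xs ! j]"
proof -
  have "filter (\<lambda>k. k \<in> {i, j}) [0..<length xs] = [i, j]"
    unfolding upt_split_at_pair[OF assms] using assms by (auto simp: filter_empty_conv)
  then show ?thesis by (simp add: nths_eq_map_filter)
qed

lemma nths_complement_adjacent_pair:
  assumes "Suc i < length xs"
  shows "nths xs ({..<length xs} - {i, Suc i}) = take i xs @ drop (Suc (Suc i)) xs"
proof -
  have "filter (\<lambda>k. k \<in> {..<length xs} - {i, Suc i}) [0..<length xs]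
      = [0..<i] @ [Suc (Suc i)..<length xs]"
    unfolding upt_split_at_pair[OF lessI assms] using assms
    by (auto simp: filter_id_conv filter_empty_conv)
  moreover have "map ((!) xs) [0..<i] = take i xs"
    using assms by (intro nth_equalityI) auto
  moreover have "map ((!) xs) [Suc (Suc i)..<length xs] = drop (Suc (Suc i)) xs"
    using assms by (intro nth_equalityI) auto
  ultimately show ?thesis by (simp add: nths_eq_map_filter)
qed

lemma wedge11_apply: "(\<theta> \<and>\<^sub>1 \<eta>) x [u, v] = \<theta> x [u] * \<eta> x [v] - \<theta> x [v] * \<eta> x [u]"
proof -
  have I: "{I. I \<subseteq> {..<1 + 1} \<and> card I = 1} = {{0}, {1::nat}}"
    by (auto simp: card_1_singleton_iff lessThan_Suc)
  have inversions: "{(i, j). i \<in> {0::nat} \<and> j \<in> {..<1 + 1} - {0} \<and> j < i} = {}"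
    "{(i, j). i \<in> {1::nat} \<and> j \<in> {..<1 + 1} - {1} \<and> j < i} = {(1, 0)}"
    by auto
  have "shuffle_sign (1 + 1) {0} = 1" "shuffle_sign (1 + 1) {1} = -1"
    unfolding shuffle_sign_def inversions by simp_all
  then show ?thesis unfolding wedge_def I by (simp add: nths_Cons)
qed

text \<open>Moving both members of an adjacent pair to the front past \<open>2 k\<close> vectors costs the even number
  \<open>4 k\<close> of transpositions.\<close>

lemma shuffle_sign_adjacent_pair:
  assumes "Suc (2 * k) < m"
  shows "shuffle_sign m {2 * k, Suc (2 * k)} = 1"
proof -
  have "{(i, j). i \<in> {2 * k, Suc (2 * k)} \<and> j \<in> {..<m} - {2 * k, Suc (2 * k)} \<and> j < i}
      = {2 * k, Suc (2 * k)} \<times> {..<2 * k}"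
    using assms by auto
  then show ?thesis unfolding shuffle_sign_def by (simp add: card_cartesian_product)
qed

text \<open>In the shuffle sum for \<open>\<theta> \<and> \<theta>\<^sup>n\<close> only the \<open>n + 1\<close> shuffles that feed a conjugate pair
  of frame vectors to the first factor survive. Each has sign 1 and leaves a symplectic frame with
  one pair fewer, whence the recursion \<open>(n + 1) * fact n\<close>.\<close>

lemma wedge_power_symplectic_frame:
  assumes "length vs = 2 * n"
    and "\<And>i j. i < j \<Longrightarrow> j < 2 * n \<Longrightarrow> \<theta> x [vs ! i, vs ! j] = (if even i \<and> j = Suc i then 1 else 0)"
  shows "wedge_power \<theta> n x vs = fact n"
  using assms
proof (induction n arbitrary: vs)
  case (Suc n)
  let ?m = "2 + 2 * n"
  let ?P = "\<lambda>k. {2 * k, Suc (2 * k)}"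
  let ?t = "\<lambda>I. shuffle_sign ?m I * \<theta> x (nths vs I) * wedge_power \<theta> n x (nths vs ({..<?m} - I))"
  have len: "length vs = ?m" using Suc.prems by simp
  have zero: "?t I = 0" if I: "I \<subseteq> {..<?m}" "card I = 2" "I \<notin> ?P ` {..n}" for I
  proof -
    obtain i j where ij: "I = {i, j}" "i < j"
      using I(2) by (metis card_2_iff insert_commute linorder_neqE_nat)
    have "\<not> (even i \<and> j = Suc i)"
      using I ij by (auto elim!: evenE)
    then show ?thesis
      using ij I(1) nths_pair[of i j vs] Suc.prems(2)[of i j] len by auto
  qed
  have one: "?t (?P k) = fact n" if k: "k \<le> n" for k
  proof -
    let ?ws = "take (2 * k) vs @ drop (Suc (Suc (2 * k))) vs"
    have "nths vs (?P k) = [vs ! (2 * k), vs ! Suc (2 * k)]"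
      using len k by (intro nths_pair) auto
    moreover have "\<theta> x [vs ! (2 * k), vs ! Suc (2 * k)] = 1"
      using Suc.prems(2)[of "2 * k" "Suc (2 * k)"] k by simp
    moreover have "nths vs ({..<?m} - ?P k) = ?ws"
      using nths_complement_adjacent_pair[of "2 * k" vs] len k by simp
    moreover have "wedge_power \<theta> n x ?ws = fact n"
    proof (rule Suc.IH)
      show lenw: "length ?ws = 2 * n" using len k by simp
      (* s translates positions in the shortened list into positions in vs; it preserves parity *)
      define s where "s = (\<lambda>i. if i < 2 * k then i else Suc (Suc i))"
      have nth: "?ws ! i = vs ! s i" if "i < 2 * n" for i
        using that len k by (auto simp: s_def nth_append min_def)
      fix i j assume ij: "i < j" "j < 2 * n"
      have "s i < s j" "s j < 2 * Suc n" using ij k by (auto simp: s_def)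
      moreover have "even (s i) = even i" "even i \<Longrightarrow> s j = Suc (s i) \<longleftrightarrow> j = Suc i"
        using ij by (auto simp: s_def elim!: evenE)
      ultimately show "\<theta> x [?ws ! i, ?ws ! j] = (if even i \<and> j = Suc i then 1 else 0)"
        using nth[of i] nth[of j] ij Suc.prems(2)[of "s i" "s j"] by auto
    qed
    moreover have "shuffle_sign ?m (?P k) = 1"
      by (rule shuffle_sign_adjacent_pair) (use k in simp)
    ultimately show ?thesis by simp
  qed
  have inj: "inj_on ?P {..n}"
    by (rule inj_onI) (auto simp: doubleton_eq_iff)
  have "wedge_power \<theta> (Suc n) x vs = (\<Sum>I | I \<subseteq> {..<?m} \<and> card I = 2. ?t I)"
    by (simp add: wedge_def)
  also have "\<dots> = (\<Sum>I\<in>?P ` {..n}. ?t I)"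
    by (rule sum.mono_neutral_right) (use zero in auto)
  also have "\<dots> = (\<Sum>k\<le>n. ?t (?P k))"
    by (rule sum.reindex_cong[OF inj]) auto
  also have "\<dots> = (\<Sum>k\<le>n. fact n)"
    by (rule sum.cong) (use one in auto)
  finally show ?case by simp
qed simp

section \<open>Orbifold structure on the quotient by a discrete group of diffeomorphisms\<close>

text \<open>The saturation of an open set is the union of its translates.\<close>

lemma quotient_map_orbits_open:
  fixes D :: "('e::topological_space \<Rightarrow> 'e) set"
  assumes q: "quotient_map euclidean X q"
    and orbit: "\<And>x y. q x = q y \<longleftrightarrow> (\<exists>g\<in>D. g x = y)"
    and open_image: "\<And>g U. g \<in> D \<Longrightarrow> open U \<Longrightarrow> open (g ` U)"
  shows "open_map euclidean X q"
  unfolding open_map_def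
proof (intro allI impI)
  fix U :: "'e set" assume "openin euclidean U"
  then have "open (\<Union>g\<in>D. g ` U)" using open_image by auto
  moreover have "{x. q x \<in> q ` U} = (\<Union>g\<in>D. g ` U)"
  proof (intro equalityI subsetI)
    fix x assume "x \<in> {x. q x \<in> q ` U}"
    then obtain u where "u \<in> U" "q u = q x" by (metis imageE mem_Collect_eq)
    then obtain g where "g \<in> D" "g u = x" using orbit[of u x] by auto
    then show "x \<in> (\<Union>g\<in>D. g ` U)" using \<open>u \<in> U\<close> by blast
  next
    fix x assume "x \<in> (\<Union>g\<in>D. g ` U)"
    then obtain g u where "g \<in> D" "u \<in> U" "g u = x" by auto
    then have "q u = q x" using orbit[of u x] by auto
    then show "x \<in> {x. q x \<in> q ` U}" using \<open>u \<in> U\<close> by (metis image_eqI mem_Collect_eq)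
  qed
  ultimately have "open {x. q x \<in> q ` U}" by simp
  moreover have "q ` U \<subseteq> topspace X"
    using quotient_imp_surjective_map[OF q] by auto
  ultimately show "openin X (q ` U)"
    using q unfolding quotient_map_def by simp
qed

text \<open>A group \<open>D\<close> of diffeomorphisms acting properly discontinuously, with \<open>\<pi>\<close> a model of the orbit
  projection. The action need not be free. Working with an arbitrary quotient map instead of the
  set of orbits lets the same results serve for cosets and for orbits of cosets.\<close>

locale discrete_smooth_action =
  fixes D :: "('e::euclidean_space \<Rightarrow> 'e) set" and X :: "'a topology" and \<pi> :: "'e \<Rightarrow> 'a"
  assumes id_mem: "id \<in> D"
    and comp_mem: "g \<in> D \<Longrightarrow> h \<in> D \<Longrightarrow> g \<circ> h \<in> D"
    and left_inverse: "g \<in> D \<Longrightarrow> \<exists>h\<in>D. h \<circ> g = id"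
    and smooth: "g \<in> D \<Longrightarrow> smooth_on UNIV g"
    and proper: "compact K \<Longrightarrow> finite {g \<in> D. g ` K \<inter> K \<noteq> {}}"
    and quotient: "quotient_map euclidean X \<pi>"
    and orbit: "\<pi> x = \<pi> y \<longleftrightarrow> (\<exists>g\<in>D. g x = y)"
begin

definition atlas :: "('e, 'a) chart set" where
  "atlas = {(U, H, \<phi>). \<phi> = \<pi> \<and> orbifold_chart X (U, H, \<phi>)}"

definition stabilizer :: "'e \<Rightarrow> ('e \<Rightarrow> 'e) set" where
  "stabilizer p = {g \<in> D. g p = p}"

lemma orbit_map: "g \<in> D \<Longrightarrow> \<pi> (g x) = \<pi> x"
  using orbit[of x "g x"] by auto

lemma orbit_obtain:
  assumes "\<pi> x = \<pi> y" obtains g where "g \<in> D" "g x = y"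
  using assms orbit[of x y] by auto

lemma inverse_ex:
  assumes "g \<in> D"
  shows "\<exists>h\<in>D. (\<forall>x. h (g x) = x) \<and> (\<forall>x. g (h x) = x)"
proof -
  obtain h where h: "h \<in> D" "h \<circ> g = id" using left_inverse assms by blast
  obtain k where k: "k \<in> D" "k \<circ> h = id" using left_inverse h by blast
  have "k = g"
    by (metis comp_assoc comp_id h(2) id_comp k(2))
  then have "h (g x) = x" "g (h x) = x" for x
    using h k by (metis comp_apply id_apply)+
  with h show ?thesis by blast
qed

lemma bij_mem: "g \<in> D \<Longrightarrow> bij g"
  using inverse_ex[of g] by (metis bijI')

lemma continuous_mem: "g \<in> D \<Longrightarrow> continuous_on S g"
  using smooth smooth_on_imp_continuous_on continuous_on_subset by blast

lemma open_vimage_mem: "g \<in> D \<Longrightarrow> open U \<Longrightarrow> open (g -` U)"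
  using continuous_mem continuous_on_open_vimage[OF open_UNIV] by fastforce

lemma open_image_mem:
  assumes "g \<in> D" "open U" shows "open (g ` U)"
proof -
  obtain h where h: "h \<in> D" "\<And>x. h (g x) = x" "\<And>x. g (h x) = x"
    using inverse_ex[OF assms(1)] by blast
  then have "g ` U = h -` U" by (auto simp: image_iff) metis
  then show ?thesis using open_vimage_mem h assms by simp
qed

lemma open_map: "open_map euclidean X \<pi>"
  using quotient_map_orbits_open[OF quotient orbit open_image_mem] .

lemma continuous: "continuous_map euclidean X \<pi>"
  using quotient quotient_imp_continuous_map by blast

lemma surjective: "range \<pi> = topspace X"
  using quotient quotient_imp_surjective_map by fastforce

lemma second_countable: "second_countable X"
proof (rule second_countable_open_map_image[OF continuous open_map])
  show "second_countable (euclidean :: 'e topology)"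
  proof -
    obtain B :: "'e set set" where B: "countable B" "topological_basis B"
      using ex_countable_basis by blast
    have "\<exists>V\<in>B. x \<in> V \<and> V \<subseteq> U" if "open U" "x \<in> U" for U x
      using topological_basisE[OF B(2) that] by metis
    then show ?thesis
      unfolding second_countable_def using B topological_basis_open[OF B(2)]
      by (intro exI[of _ B]) auto
  qed
qed (use surjective in simp)

lemma countable: "countable D"
proof (rule countable_subset)
  (* every g moves 0 within some closed ball around 0, and for each ball only finitely many do *)
  let ?F = "\<lambda>n. {g \<in> D. g ` cball 0 (real n) \<inter> cball 0 (real n) \<noteq> {}}"
  show "D \<subseteq> (\<Union>n. ?F n)"
  proof
    fix g assume g: "g \<in> D"
    obtain n where "norm (g 0) \<le> real n" using real_arch_simple by blast
    then have "g 0 \<in> g ` cball 0 (real n) \<inter> cball 0 (real n)" by simp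
    then show "g \<in> (\<Union>n. ?F n)" using g by blast
  qed
  show "countable (\<Union>n. ?F n)"
    using proper compact_cball by (intro countable_UN) (auto intro: countable_finite)
qed

text \<open>Finitely many Hausdorff separations can be intersected; properness of the action will reduce
  every separation problem to this one.\<close>

lemma separating_neighbourhoods:
  assumes "finite F" "F \<subseteq> D" "\<forall>g\<in>F. g x \<noteq> y"
  shows "\<exists>U V. open U \<and> open V \<and> x \<in> U \<and> y \<in> V \<and> (\<forall>g\<in>F. g ` U \<inter> V = {})"
proof -
  have "\<exists>A B. open A \<and> open B \<and> g x \<in> A \<and> y \<in> B \<and> A \<inter> B = {}" if "g \<in> F" for g
    using hausdorff assms(3) that by blast
  then obtain A B where AB: "\<And>g. g \<in> F \<Longrightarrow> open (A g) \<and> open (B g) \<and> g x \<in> A g \<and> y \<in> B g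
      \<and> A g \<inter> B g = {}"
    by metis
  show ?thesis
  proof (intro exI conjI ballI)
    show "open (\<Inter>g\<in>F. g -` A g)" "open (\<Inter>g\<in>F. B g)"
      using assms(1,2) AB open_vimage_mem by (auto intro!: open_INT)
    show "x \<in> (\<Inter>g\<in>F. g -` A g)" "y \<in> (\<Inter>g\<in>F. B g)" using AB by auto
    show "g ` (\<Inter>g\<in>F. g -` A g) \<inter> (\<Inter>g\<in>F. B g) = {}" if "g \<in> F" for g
      using AB[OF that] that by blast
  qed
qed

lemma Hausdorff: "Hausdorff_space X"
  unfolding Hausdorff_space_def
proof (intro allI impI, elim conjE)
  fix a b assume "a \<in> topspace X" "b \<in> topspace X" "a \<noteq> b"
  then obtain x y where xy: "\<pi> x = a" "\<pi> y = b" "\<pi> x \<noteq> \<pi> y"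
    using surjective by (metis rangeE)
  define K where "K = cball x 1 \<union> cball y 1"
  let ?F = "{g \<in> D. g ` K \<inter> K \<noteq> {}}"
  have F: "finite ?F" "?F \<subseteq> D" using proper[of K] by (auto simp: K_def compact_Un)
  have "\<forall>g\<in>?F. g x \<noteq> y"
    using xy(3) orbit_map[of _ x] by auto
  from separating_neighbourhoods[of ?F x y, OF F this]
  obtain U V where UV: "open U" "open V" "x \<in> U" "y \<in> V" "\<forall>g\<in>?F. g ` U \<inter> V = {}"
    by (elim exE conjE)
  define U' V' where "U' = U \<inter> ball x 1" and "V' = V \<inter> ball y 1"
  have sub: "U' \<subseteq> U \<inter> K" "V' \<subseteq> V \<inter> K" by (auto simp: U'_def V'_def K_def)
  have disj: "g ` U' \<inter> V' = {}" if "g \<in> D" for g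
  proof (cases "g \<in> ?F")
    case True then show ?thesis using UV(5) sub by blast
  next
    case False then show ?thesis using that sub by blast
  qed
  show "\<exists>U V. openin X U \<and> openin X V \<and> a \<in> U \<and> b \<in> V \<and> disjnt U V"
  proof (intro exI conjI)
    show "openin X (\<pi> ` U')" "openin X (\<pi> ` V')"
      using open_map UV by (auto simp: open_map_def U'_def V'_def open_Int)
    show "a \<in> \<pi> ` U'" "b \<in> \<pi> ` V'"
      using xy UV by (auto simp: U'_def V'_def)
    show "disjnt (\<pi> ` U') (\<pi> ` V')"
      unfolding disjnt_iff using disj by (auto elim!: orbit_obtain)
  qed
qed

lemma stabilizer_group:
  shows "id \<in> stabilizer p"
    and "g \<in> stabilizer p \<Longrightarrow> h \<in> stabilizer p \<Longrightarrow> g \<circ> h \<in> stabilizer p"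
    and "g \<in> stabilizer p \<Longrightarrow> \<exists>h\<in>stabilizer p. (\<forall>x. h (g x) = x) \<and> (\<forall>x. g (h x) = x)"
proof -
  assume g: "g \<in> stabilizer p"
  obtain h where h: "h \<in> D" "\<And>x. h (g x) = x" "\<And>x. g (h x) = x"
    using inverse_ex g unfolding stabilizer_def by blast
  moreover have "h p = p" using h(2)[of p] g by (simp add: stabilizer_def)
  ultimately show "\<exists>h\<in>stabilizer p. (\<forall>x. h (g x) = x) \<and> (\<forall>x. g (h x) = x)"
    unfolding stabilizer_def by blast
qed (auto simp: stabilizer_def id_mem comp_mem)

lemma finite_stabilizer: "finite (stabilizer p)"
  by (rule finite_subset[OF _ proper[of "{p}"]]) (auto simp: stabilizer_def)

text \<open>Only finitely many group elements move the unit ball around \<open>p\<close> to meet itself, and those that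
  do not fix \<open>p\<close> can be separated away. Intersecting the translates of the resulting neighbourhood
  under the finite stabilizer makes it invariant, and the component of \<open>p\<close> stays invariant because
  the stabilizer fixes \<open>p\<close>.\<close>

lemma slice:
  obtains U where "open U" "connected U" "p \<in> U" "\<And>g. g \<in> stabilizer p \<Longrightarrow> g ` U = U"
    and "\<And>g. g \<in> D \<Longrightarrow> g ` U \<inter> U \<noteq> {} \<Longrightarrow> g \<in> stabilizer p"
proof -
  let ?F = "{g \<in> D. g ` cball p 1 \<inter> cball p 1 \<noteq> {}} - stabilizer p"
  have F: "finite ?F" "?F \<subseteq> D" using proper[of "cball p 1"] by auto
  have "\<forall>g\<in>?F. g p \<noteq> p" by (simp add: stabilizer_def)
  from separating_neighbourhoods[of ?F p p, OF F this]
  obtain A B where AB: "open A" "open B" "p \<in> A" "p \<in> B" "\<forall>g\<in>?F. g ` A \<inter> B = {}"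
    by (elim exE conjE)
  define C where "C = A \<inter> B \<inter> ball p 1"
  have C: "g \<in> stabilizer p" if "g \<in> D" "g ` C \<inter> C \<noteq> {}" for g
  proof (rule ccontr)
    assume *: "g \<notin> stabilizer p"
    have "C \<subseteq> cball p 1" by (auto simp: C_def)
    then have "g \<in> ?F" using that * by blast
    then have "g ` A \<inter> B = {}" using AB(5) by blast
    then show False using that by (auto simp: C_def)
  qed
  define S where "S = (\<Inter>h\<in>stabilizer p. h -` C)"
  have S_open: "open S"
    unfolding S_def using AB finite_stabilizer
    by (intro open_INT ballI open_vimage_mem) (auto simp: C_def stabilizer_def)
  have "p \<in> S" using AB by (auto simp: S_def C_def stabilizer_def)
  have S_inv: "g ` S \<subseteq> S" if "g \<in> stabilizer p" for g
    using stabilizer_group(2)[OF _ that] by (force simp: S_def)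
  have "S \<subseteq> C" using stabilizer_group(1) by (force simp: S_def)
  define U where "U = connected_component_set S p"
  have "p \<in> U" "U \<subseteq> S"
    using \<open>p \<in> S\<close> connected_component_subset by (auto simp: U_def)
  have sub: "g ` U \<subseteq> U" if "g \<in> stabilizer p" for g
    unfolding U_def
  proof (rule connected_component_maximal)
    have "g p = p" "g \<in> D" using that by (auto simp: stabilizer_def)
    then show "p \<in> g ` connected_component_set S p"
      using \<open>p \<in> U\<close> unfolding U_def by (metis image_eqI)
    show "connected (g ` connected_component_set S p)"
      using \<open>g \<in> D\<close> by (intro connected_continuous_image continuous_mem connected_connected_component)
    show "g ` connected_component_set S p \<subseteq> S"
      using S_inv[OF that] \<open>U \<subseteq> S\<close> unfolding U_def by blast
  qed
  show thesis
  proof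
    show "open U" unfolding U_def using S_open by (rule open_connected_component)
    show "connected U" by (simp add: U_def)
    show "p \<in> U" by fact
    show "g ` U = U" if "g \<in> stabilizer p" for g
    proof
      note inv = stabilizer_group(3)[OF that]
      obtain h where h: "h \<in> stabilizer p" "\<forall>x. g (h x) = x" using inv by blast
      show "U \<subseteq> g ` U" using sub[OF h(1)] h(2) by (metis image_eqI image_subset_iff subsetI)
    qed (use sub that in blast)
    show "g \<in> stabilizer p" if "g \<in> D" "g ` U \<inter> U \<noteq> {}" for g
      using C that \<open>U \<subseteq> S\<close> \<open>S \<subseteq> C\<close> by blast
  qed
qed

text \<open>Chart groups consist of extensional bijections of the chart domain, hence the restrictions.\<close>

lemma subgroup_restrict_stabilizer:
  assumes "\<And>g. g \<in> stabilizer p \<Longrightarrow> g ` U = U"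
  shows "subgroup ((\<lambda>g. restrict g U) ` stabilizer p) (BijGroup U)"
proof -
  let ?H = "(\<lambda>g. restrict g U) ` stabilizer p"
  have Bij: "restrict g U \<in> Bij U" if "g \<in> stabilizer p" for g
    using assms[OF that] bij_mem[of g] that
    by (auto simp: Bij_def bij_betw_def stabilizer_def inj_on_def bij_def)
  show ?thesis
  proof (rule group.subgroupI[OF group_BijGroup])
    show "?H \<subseteq> carrier (BijGroup U)" using Bij by (auto simp: BijGroup_def)
    show "?H \<noteq> {}" using stabilizer_group(1) by blast
    fix a assume "a \<in> ?H"
    then obtain g where g: "g \<in> stabilizer p" "a = restrict g U" by blast
    obtain h where h: "h \<in> stabilizer p" "\<forall>x. h (g x) = x" "\<forall>x. g (h x) = x"
      using stabilizer_group(3)[OF g(1)] by blast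
    have "inv\<^bsub>BijGroup U\<^esub> a = restrict h U"
    proof (rule group.inv_equality[OF group_BijGroup])
      show "restrict h U \<otimes>\<^bsub>BijGroup U\<^esub> a = \<one>\<^bsub>BijGroup U\<^esub>"
        using Bij[OF h(1)] Bij[OF g(1)] h(2) assms[OF g(1)]
        by (auto simp: BijGroup_def g(2) compose_def fun_eq_iff)
    qed (use Bij g h in \<open>auto simp: BijGroup_def\<close>)
    then show "inv\<^bsub>BijGroup U\<^esub> a \<in> ?H" using h(1) by blast
    fix b assume "b \<in> ?H"
    then obtain k where k: "k \<in> stabilizer p" "b = restrict k U" by blast
    have "a \<otimes>\<^bsub>BijGroup U\<^esub> b = restrict (g \<circ> k) U"
      using Bij[OF k(1)] Bij[OF g(1)] assms[OF k(1)]
      by (auto simp: BijGroup_def g(2) k(2) compose_def fun_eq_iff)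
    then show "a \<otimes>\<^bsub>BijGroup U\<^esub> b \<in> ?H" using stabilizer_group(2)[OF g(1) k(1)] by blast
  qed
qed

lemma chart_around:
  obtains U where "p \<in> U" "orbifold_chart X (U, (\<lambda>g. restrict g U) ` stabilizer p, \<pi>)"
proof -
  obtain U where U: "open U" "connected U" "p \<in> U" and inv: "\<And>g. g \<in> stabilizer p \<Longrightarrow> g ` U = U"
    and ret: "\<And>g. g \<in> D \<Longrightarrow> g ` U \<inter> U \<noteq> {} \<Longrightarrow> g \<in> stabilizer p"
    using slice[of p] by blast
  have openU: "openin X (\<pi> ` U)" using open_map U(1) by (simp add: open_map_def)
  have "quotient_map (top_of_set U) (subtopology X (\<pi> ` U)) \<pi>"
  proof (rule continuous_open_imp_quotient_map)
    show "continuous_map (top_of_set U) (subtopology X (\<pi> ` U)) \<pi>"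
      using continuous by (auto simp: continuous_map_in_subtopology continuous_map_from_subtopology)
    show "open_map (top_of_set U) (subtopology X (\<pi> ` U)) \<pi>"
      using open_map U(1) by (intro open_map_into_subtopology open_map_from_subtopology) auto
    show "\<pi> ` topspace (top_of_set U) = topspace (subtopology X (\<pi> ` U))"
      using surjective by auto
  qed
  moreover have "\<pi> x = \<pi> y \<longleftrightarrow> (\<exists>h\<in>(\<lambda>g. restrict g U) ` stabilizer p. h x = y)"
    if "x \<in> U" "y \<in> U" for x y
  proof
    assume "\<pi> x = \<pi> y"
    then obtain g where "g \<in> D" "g x = y" by (rule orbit_obtain)
    then have "g \<in> stabilizer p" using ret that by blast
    then show "\<exists>h\<in>(\<lambda>g. restrict g U) ` stabilizer p. h x = y"
      using \<open>g x = y\<close> that by force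
  next
    assume "\<exists>h\<in>(\<lambda>g. restrict g U) ` stabilizer p. h x = y"
    then show "\<pi> x = \<pi> y" using that by (auto simp: orbit_map stabilizer_def)
  qed
  moreover have "smooth_on U (restrict g U)" if "g \<in> stabilizer p" for g
    using that smooth_on_cong[OF U(1) _ smooth_on_subset[OF smooth, of g U]]
    by (auto simp: stabilizer_def)
  ultimately have "orbifold_chart X (U, (\<lambda>g. restrict g U) ` stabilizer p, \<pi>)"
    using U openU finite_stabilizer subgroup_restrict_stabilizer[OF inv]
    by (auto simp: orbifold_chart_def)
  then show thesis using that U by blast
qed

text \<open>Two points over the same point of \<open>X\<close> differ by an element of \<open>D\<close>, and that element itself is the
  change of charts.\<close>

lemma compatible:
  assumes "c \<in> atlas" "d \<in> atlas" shows "charts_compatible c d"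
proof -
  obtain U H V K where cd: "c = (U, H, \<pi>)" "d = (V, K, \<pi>)"
    and ch: "orbifold_chart X c" "orbifold_chart X d"
    using assms by (auto simp: atlas_def)
  have "open U" "open V" using ch by (auto simp: cd orbifold_chart_def)
  have "\<exists>W W' \<tau>. x \<in> W \<and> W \<subseteq> U \<and> W' \<subseteq> V \<and> diffeo_on W W' \<tau> \<and> \<tau> x = y \<and> (\<forall>w\<in>W. \<pi> (\<tau> w) = \<pi> w)"
    if "x \<in> U" "y \<in> V" "\<pi> x = \<pi> y" for x y
  proof -
    obtain g where g: "g \<in> D" "g x = y" using \<open>\<pi> x = \<pi> y\<close> by (rule orbit_obtain)
    obtain h where h: "h \<in> D" "\<And>x. h (g x) = x" "\<And>x. g (h x) = x" using inverse_ex[OF g(1)] by blast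
    define W where "W = U \<inter> g -` V"
    have "open W" using \<open>open U\<close> \<open>open V\<close> g by (auto simp: W_def intro: open_vimage_mem)
    have inj: "inj_on g W" using h by (metis inj_on_inverseI)
    have "diffeo_on W (g ` W) g"
      unfolding diffeo_on_def
    proof (intro conjI)
      show "open (g ` W)" using open_image_mem g \<open>open W\<close> by blast
      show "smooth_on W g" using smooth[OF g(1)] smooth_on_subset by blast
      show "smooth_on (g ` W) (inv_into W g)"
      proof (rule smooth_on_cong[OF \<open>open (g ` W)\<close>])
        show "smooth_on (g ` W) h" using smooth[OF h(1)] smooth_on_subset by blast
        show "h z = inv_into W g z" if "z \<in> g ` W" for z
          using that inj h(2) by auto
      qed
    qed (use \<open>open W\<close> inj in \<open>auto simp: bij_betw_def\<close>)
    moreover have "\<forall>w\<in>W. \<pi> (g w) = \<pi> w" using orbit_map g by blast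
    ultimately show ?thesis using that g by (intro exI[of _ W] exI[of _ "g ` W"] exI[of _ g]) (auto simp: W_def)
  qed
  then show ?thesis by (simp add: charts_compatible_def cd)
qed

text \<open>Subatlases are admitted because an atlas of a manifold keeps only the charts with trivial group.\<close>

definition covering_atlas :: "('e, 'a) chart set \<Rightarrow> bool" where
  "covering_atlas A \<longleftrightarrow> A \<subseteq> atlas \<and> (\<forall>p. \<exists>c\<in>A. p \<in> fst c)"

lemma covering_atlas_full: "covering_atlas atlas"
  unfolding covering_atlas_def
proof (intro conjI allI)
  fix p
  obtain U where "p \<in> U" "orbifold_chart X (U, (\<lambda>g. restrict g U) ` stabilizer p, \<pi>)"
    using chart_around by blast
  then show "\<exists>c\<in>atlas. p \<in> fst c" unfolding atlas_def by force
qed simp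

lemma covering_atlas_free:
  assumes "\<And>g p. g \<in> D \<Longrightarrow> g p = p \<Longrightarrow> g = id"
  shows "covering_atlas {(U, H, \<phi>). \<phi> = \<pi> \<and> H = {\<lambda>x\<in>U. x} \<and> orbifold_chart X (U, H, \<phi>)}"
  unfolding covering_atlas_def
proof (intro conjI allI)
  fix p
  have "stabilizer p = {id}" using assms id_mem by (auto simp: stabilizer_def)
  moreover obtain U where "p \<in> U" "orbifold_chart X (U, (\<lambda>g. restrict g U) ` stabilizer p, \<pi>)"
    using chart_around by blast
  ultimately have "p \<in> U" "orbifold_chart X (U, {\<lambda>x\<in>U. x}, \<pi>)"
    by (simp_all add: id_def restrict_def)
  then show "\<exists>c\<in>{(U, H, \<phi>). \<phi> = \<pi> \<and> H = {\<lambda>x\<in>U. x} \<and> orbifold_chart X (U, H, \<phi>)}. p \<in> fst c"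
    by force
qed (auto simp: atlas_def)

lemma orbifold:
  assumes "covering_atlas A" shows "orbifold X A"
  unfolding orbifold_def
proof (intro conjI)
  have A: "c \<in> A \<Longrightarrow> c \<in> atlas" for c using assms by (auto simp: covering_atlas_def)
  show "Hausdorff_space X" by (rule Hausdorff)
  show "second_countable X" by (rule second_countable)
  show "\<forall>c\<in>A. orbifold_chart X c" using A by (auto simp: atlas_def)
  show "\<forall>c\<in>A. \<forall>d\<in>A. charts_compatible c d" using A compatible by blast
  show "(\<Union>(U, H, \<phi>)\<in>A. \<phi> ` U) = topspace X"
  proof (intro equalityI subsetI)
    fix a assume "a \<in> (\<Union>(U, H, \<phi>)\<in>A. \<phi> ` U)"
    then show "a \<in> topspace X" using A surjective by (force simp: atlas_def)
  next
    fix a assume "a \<in> topspace X"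
    then obtain p where p: "a = \<pi> p" using surjective by blast
    obtain c where "c \<in> A" "p \<in> fst c" using assms unfolding covering_atlas_def by blast
    moreover obtain U H where "c = (U, H, \<pi>)" using A[OF \<open>c \<in> A\<close>] by (auto simp: atlas_def)
    ultimately show "a \<in> (\<Union>(U, H, \<phi>)\<in>A. \<phi> ` U)" using p by force
  qed
qed

text \<open>The closed sets on which \<open>\<tau>\<close> agrees with one of the countably many \<open>g\<close> cover \<open>W\<close>, so one of
  them has interior points. Agreement near a prescribed point is not to be expected: for the
  reflection group of the line, \<open>\<lambda>x. \<bar>x\<bar>\<close> agrees with different elements on the two sides of 0.\<close>

lemma Baire_agreement:
  assumes "open W" "W \<noteq> {}" "continuous_on W \<tau>" "\<And>w. w \<in> W \<Longrightarrow> \<exists>g\<in>D. \<tau> w = g w"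
  obtains g V where "g \<in> D" "open V" "V \<noteq> {}" "V \<subseteq> W" "\<And>w. w \<in> V \<Longrightarrow> \<tau> w = g w"
proof -
  obtain a e where ae: "0 < e" "cball a e \<subseteq> W"
    using assms(1,2) open_contains_cball by blast
  define C where "C = (\<lambda>g. {w \<in> cball a e. \<tau> w = g w})"
  have closed: "closed (C g)" if "g \<in> D" for g
  proof -
    have "continuous_on (cball a e) (\<lambda>w. \<tau> w - g w)"
      using ae assms(3) continuous_mem[OF that] by (intro continuous_intros) (auto intro: continuous_on_subset)
    then have "closed {w \<in> cball a e. \<tau> w - g w = 0}"
      by (rule continuous_closed_preimage_constant) simp
    then show ?thesis by (simp add: C_def)
  qed
  have "\<exists>g\<in>D. interior (C g) \<noteq> {}"
  proof (rule ccontr)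
    assume "\<not> ?thesis"
    then have "UNIV \<subseteq> closure (\<Inter>g\<in>D. - C g)"
      using closed countable
      by (intro Baire) (auto simp: closure_complement open_closed[symmetric] open_Compl)
    moreover have "(\<Inter>g\<in>D. - C g) \<subseteq> - ball a e"
      using assms(4) ae by (force simp: C_def)
    then have "closure (\<Inter>g\<in>D. - C g) \<subseteq> - ball a e"
      by (rule closure_minimal) (simp add: open_closed[symmetric])
    ultimately show False using ae(1) by (metis ComplD UNIV_I centre_in_ball subsetD)
  qed
  then obtain g where g: "g \<in> D" "interior (C g) \<noteq> {}" by blast
  have "interior (C g) \<subseteq> cball a e" "\<And>w. w \<in> interior (C g) \<Longrightarrow> \<tau> w = g w"
    using interior_subset[of "C g"] by (auto simp: C_def)
  then show thesis
    using that[OF g(1) open_interior g(2)] ae(2) by blast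
qed

definition invariant_form :: "nat \<Rightarrow> 'e form \<Rightarrow> bool" where
  "invariant_form k \<theta> \<longleftrightarrow> smooth_form k UNIV \<theta> \<and>
     (\<forall>g\<in>D. \<forall>x vs. length vs = k \<longrightarrow> pullback g \<theta> x vs = \<theta> x vs)"

text \<open>By the Baire argument, \<open>\<tau>\<close> agrees with elements of \<open>D\<close> on a dense open set, and there the claim
  is the invariance of \<open>\<theta>\<close>. It extends to all of \<open>W\<close> since both sides are continuous in the
  point. This is what makes an invariant form independent of the choice of local lifts, also at
  singular points.\<close>

lemma pullback_along_orbits:
  assumes "invariant_form k \<theta>" "open W" "smooth_on W \<tau>"
    and "\<And>w. w \<in> W \<Longrightarrow> \<exists>g\<in>D. \<tau> w = g w" and "x \<in> W" "length vs = k"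
  shows "pullback \<tau> \<theta> x vs = \<theta> x vs"
proof (rule ccontr)
  assume neq: "pullback \<tau> \<theta> x vs \<noteq> \<theta> x vs"
  have \<theta>: "smooth_form k UNIV \<theta>" using assms(1) by (simp add: invariant_form_def)
  have "continuous_on W (\<lambda>y. \<theta> y vs)"
    using \<theta> assms(6) smooth_on_imp_continuous_on continuous_on_subset
    unfolding smooth_form_def by blast
  then have "continuous_on W (\<lambda>y. pullback \<tau> \<theta> y vs - \<theta> y vs)"
    using continuous_on_pullback[OF \<theta> assms(3,6)] by (intro continuous_intros)
  then have "open (W \<inter> (\<lambda>y. pullback \<tau> \<theta> y vs - \<theta> y vs) -` (- {0}))" (is "open ?N")
    using assms(2) by (rule continuous_open_preimage) (simp add: open_Compl)
  moreover have "x \<in> ?N" using neq assms(5) by simp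
  moreover have "continuous_on ?N \<tau>"
    using smooth_on_imp_continuous_on[OF assms(3)] continuous_on_subset by blast
  ultimately obtain g V where gV: "g \<in> D" "open V" "V \<noteq> {}" "V \<subseteq> ?N" "\<And>w. w \<in> V \<Longrightarrow> \<tau> w = g w"
    using Baire_agreement[of ?N \<tau>] assms(4) by blast
  then obtain y where y: "y \<in> V" by blast
  have "g differentiable at y" using smooth_on_imp_differentiable[OF smooth[OF gV(1)]] by simp
  then have "frechet_derivative g (at y) = frechet_derivative \<tau> (at y)"
    using gV y by (intro frechet_derivative_transform_within_open[where X = V]) auto
  then have "pullback \<tau> \<theta> y vs = pullback g \<theta> y vs"
    using gV y by (simp add: pullback_def)
  also have "\<dots> = \<theta> y vs" using assms(1,6) gV(1) by (simp add: invariant_form_def)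
  finally show False using gV(4) y by auto
qed

end

text \<open>Any local lift of \<open>f\<close> takes \<open>w\<close> to \<open>g (\<Phi> w)\<close> for some \<open>g \<in> E\<close>, which lies in the orbit of \<open>w\<close> under
  any group \<open>F\<close> containing \<open>E\<close> and \<open>\<Phi>\<close>; invariance under \<open>F\<close> then gives the claim. A third group is allowed since an automorphism such as \<open>rho\<close>
  normalises the group of the target without belonging to it.\<close>

lemma is_pullback_of_lift:
  fixes D :: "('e::euclidean_space \<Rightarrow> 'e) set"
  assumes X: "discrete_smooth_action D X p" "discrete_smooth_action.covering_atlas X p A"
    and Y: "discrete_smooth_action E Y q" "discrete_smooth_action.covering_atlas Y q B"
    and Z: "discrete_smooth_action F Z r" "discrete_smooth_action.invariant_form F k \<theta>"
    and \<Phi>: "\<Phi> \<in> F" "E \<subseteq> F" and f: "\<And>x. f (p x) = q (\<Phi> x)"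
  shows "is_pullback f A B k (\<lambda>c. \<theta>) (\<lambda>c. \<theta>)"
proof -
  interpret X: discrete_smooth_action D X p by fact
  interpret Y: discrete_smooth_action E Y q by fact
  interpret Z: discrete_smooth_action F Z r by fact
  have A: "\<exists>U H. c = (U, H, p) \<and> open U" if "c \<in> A" for c
    using that X(2) by (auto simp: X.covering_atlas_def X.atlas_def orbifold_chart_def)
  have B: "\<exists>V K. d = (V, K, q) \<and> open V" if "d \<in> B" for d
    using that Y(2) by (auto simp: Y.covering_atlas_def Y.atlas_def orbifold_chart_def)
  show ?thesis
    unfolding is_pullback_def
  proof (intro conjI ballI allI impI)
    show "smooth_map f A B"
      unfolding smooth_map_def
    proof (intro ballI)
      fix c x assume c: "c \<in> A" "x \<in> fst c"
      obtain d where d: "d \<in> B" "\<Phi> x \<in> fst d" using Y(2) unfolding Y.covering_atlas_def by blast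
      obtain U H V K where UV: "c = (U, H, p)" "open U" "d = (V, K, q)" "open V"
        using A[OF c(1)] B[OF d(1)] by blast
      have "local_lift f c d (U \<inter> \<Phi> -` V) \<Phi>"
        using UV f smooth_on_subset[OF Z.smooth[OF \<Phi>(1)]] Z.open_vimage_mem[OF \<Phi>(1)]
        by (auto simp: local_lift_def)
      then show "\<exists>d\<in>B. \<exists>W \<tau>. x \<in> W \<and> local_lift f c d W \<tau>"
        using c d UV by (intro bexI[of _ d] exI[of _ "U \<inter> \<Phi> -` V"] exI[of _ \<Phi>]) auto
    qed
    fix c d W \<tau> x and vs :: "'e list"
    assume c: "c \<in> A" and d: "d \<in> B" and lift: "local_lift f c d W \<tau>"
      and x: "x \<in> W" and vs: "length vs = k"
    obtain U H V K where UV: "c = (U, H, p)" "d = (V, K, q)" using A[OF c] B[OF d] by blast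
    have W: "open W" "smooth_on W \<tau>" "\<And>w. w \<in> W \<Longrightarrow> q (\<tau> w) = f (p w)"
      using lift by (auto simp: local_lift_def UV)
    have "\<exists>g\<in>F. \<tau> w = g w" if "w \<in> W" for w
    proof -
      have "q (\<Phi> w) = q (\<tau> w)" using W(3)[OF that] f by simp
      then obtain g where "g \<in> E" "g (\<Phi> w) = \<tau> w" by (rule Y.orbit_obtain)
      then show ?thesis using Z.comp_mem[OF _ \<Phi>(1)] \<Phi>(2) by (intro bexI[of _ "g \<circ> \<Phi>"]) auto
    qed
    then show "pullback \<tau> \<theta> x vs = \<theta> x vs"
      using Z.pullback_along_orbits[OF Z(2) W(1,2) _ x vs] by blast
  qed
qed

section \<open>Coset projections, product maps and integral points\<close>

lemma (in group) coset_eq_iff_orbit: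
  assumes "subgroup S G" "x \<in> carrier G" "y \<in> carrier G"
  shows "S #> x = S #> y \<longleftrightarrow> (\<exists>s\<in>S. s \<otimes> x = y)"
proof
  assume "S #> x = S #> y"
  then have "y \<in> S #> x" using rcos_self assms by metis
  then show "\<exists>s\<in>S. s \<otimes> x = y" by (auto simp: r_coset_def)
next
  assume "\<exists>s\<in>S. s \<otimes> x = y"
  then have "y \<in> S #> x" by (auto simp: r_coset_def)
  then show "S #> x = S #> y" using repr_independence assms by metis
qed

lemma open_map_coset_projection:
  fixes L :: "('a::topological_space, 'b) monoid_scheme" (structure)
  assumes "group L" and S: "subgroup S L" and UNIV: "carrier L = UNIV"
    and cont: "\<And>a. continuous_on UNIV (\<lambda>x. a \<otimes> x)"
  shows "open_map euclidean (quotient_topology euclidean (\<lambda>x. S #> x)) (\<lambda>x. S #> x)"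
proof -
  interpret group L by fact
  show ?thesis
  proof (rule quotient_map_orbits_open[where D = "(\<lambda>s x. s \<otimes> x) ` S"])
    show "quotient_map euclidean (quotient_topology euclidean (\<lambda>x. S #> x)) (\<lambda>x. S #> x)"
      by (rule quotient_map_quotient_topology)
    show "S #> x = S #> y \<longleftrightarrow> (\<exists>g\<in>(\<lambda>s x. s \<otimes> x) ` S. g x = y)" for x y
      using coset_eq_iff_orbit[OF S] UNIV by auto
    fix g and U :: "'a set" assume "g \<in> (\<lambda>s x. s \<otimes> x) ` S" "open U"
    then obtain s where s: "g = (\<lambda>x. s \<otimes> x)" by blast
    have "g ` U = (\<lambda>x. inv s \<otimes> x) -` U"
    proof (intro equalityI subsetI)
      fix y assume "y \<in> (\<lambda>x. inv s \<otimes> x) -` U"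
      moreover have "y = s \<otimes> (inv s \<otimes> y)" using UNIV by (simp add: m_assoc[symmetric])
      ultimately show "y \<in> g ` U" unfolding s by blast
    qed (use UNIV in \<open>auto simp: s m_assoc[symmetric]\<close>)
    then show "open (g ` U)"
      using continuous_on_open_vimage[OF open_UNIV] cont \<open>open U\<close> by force
  qed
qed

lemma (in group) image_coset:
  assumes "h \<in> hom G G" "subgroup S G" "h ` S = S" "x \<in> carrier G"
  shows "h ` (S #> x) = S #> h x"
proof -
  have "h (s \<otimes> x) = h s \<otimes> h x" if "s \<in> S" for s
    using assms that by (auto simp: hom_def dest: subgroup.mem_carrier)
  then have "h ` (S #> x) = (\<Union>s\<in>S. {h s \<otimes> h x})"
    unfolding r_coset_def image_UN by auto
  also have "\<dots> = (\<Union>s\<in>h ` S. {s \<otimes> h x})" by blast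
  finally show ?thesis using assms(3) by (simp add: r_coset_def)
qed

text \<open>A product of quotient maps need not be a quotient map; openness is the property that survives
  products.\<close>

lemma open_map_map_prod:
  assumes "open_map X X' f" "open_map Y Y' g"
  shows "open_map (prod_topology X Y) (prod_topology X' Y') (map_prod f g)"
  unfolding open_map_def
proof (intro allI impI)
  fix W assume W: "openin (prod_topology X Y) W"
  show "openin (prod_topology X' Y') (map_prod f g ` W)"
    unfolding openin_prod_topology_alt
  proof (intro allI impI)
    fix a b assume "(a, b) \<in> map_prod f g ` W"
    then obtain x y where xy: "(x, y) \<in> W" "a = f x" "b = g y" by auto
    then obtain U V where UV: "openin X U" "openin Y V" "x \<in> U" "y \<in> V" "U \<times> V \<subseteq> W"
      using W unfolding openin_prod_topology_alt by metis
    have "openin X' (f ` U)" "openin Y' (g ` V)"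
      using UV assms by (simp_all add: open_map_def)
    moreover have "f ` U \<times> g ` V \<subseteq> map_prod f g ` W" using UV(5) by force
    ultimately show "\<exists>U V. openin X' U \<and> openin Y' V \<and> a \<in> U \<and> b \<in> V \<and> U \<times> V \<subseteq> map_prod f g ` W"
      using xy UV by blast
  qed
qed

lemma finite_bounded_integral_points:
  fixes B :: "'a::euclidean_space set"
  assumes "bounded B" shows "finite {p \<in> B. \<forall>b\<in>Basis. p \<bullet> b \<in> \<int>}"
proof -
  obtain r where r: "\<And>p. p \<in> B \<Longrightarrow> norm p \<le> r" using assms by (auto simp: bounded_iff)
  let ?P = "{p \<in> B. \<forall>b\<in>Basis. p \<bullet> b \<in> \<int>}"
  let ?f = "\<lambda>p. \<lambda>b\<in>Basis. \<lfloor>p \<bullet> b\<rfloor>"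
  have "inj_on ?f ?P"
  proof (rule inj_onI)
    fix p q assume p: "p \<in> ?P" and q: "q \<in> ?P" and eq: "?f p = ?f q"
    have "p \<bullet> b = q \<bullet> b" if "b \<in> Basis" for b
    proof -
      have "\<lfloor>p \<bullet> b\<rfloor> = \<lfloor>q \<bullet> b\<rfloor>" using fun_cong[OF eq, of b] that by simp
      moreover have "p \<bullet> b \<in> \<int>" "q \<bullet> b \<in> \<int>" using p q that by auto
      ultimately show ?thesis by (auto elim!: Ints_cases)
    qed
    then show "p = q" by (rule euclidean_eqI)
  qed
  moreover have "?f ` ?P \<subseteq> Basis \<rightarrow>\<^sub>E {- \<lceil>r\<rceil>..\<lceil>r\<rceil>}"
  proof (intro image_subsetI PiE_I)
    fix p and b :: 'a assume "p \<in> ?P" "b \<in> Basis"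
    then have "\<bar>p \<bullet> b\<bar> \<le> r" using r[of p] Basis_le_norm[of b p] by auto
    then show "?f p b \<in> {- \<lceil>r\<rceil>..\<lceil>r\<rceil>}" using \<open>b \<in> Basis\<close> by (simp; linarith)
  qed auto
  moreover have "finite ((Basis :: 'a set) \<rightarrow>\<^sub>E {- \<lceil>r\<rceil>..\<lceil>r\<rceil>})" by (intro finite_PiE) auto
  ultimately show ?thesis by (meson finite_imageD finite_subset)
qed

section \<open>The lattice and the deck group of the nilmanifold quotient\<close>

lemma point_cases:
  fixes p :: "r2 \<times> r6"
  obtains x1 x2 y1 y2 z1 z2 v1 v2 where "p = ((x1, x2), (y1, y2, z1, z2, v1, v2))"
  by (metis surj_pair)

lemma crd_eq:
  "crd_x1 = (\<lambda>p. fst (fst p))" "crd_x2 = (\<lambda>p. snd (fst p))"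
  "crd_y1 = (\<lambda>p. fst (snd p))" "crd_y2 = (\<lambda>p. fst (snd (snd p)))"
  "crd_z1 = (\<lambda>p. fst (snd (snd (snd p))))" "crd_z2 = (\<lambda>p. fst (snd (snd (snd (snd p)))))"
  "crd_v1 = (\<lambda>p. fst (snd (snd (snd (snd (snd p))))))"
  "crd_v2 = (\<lambda>p. snd (snd (snd (snd (snd (snd p))))))"
  by (auto simp: fun_eq_iff)

definition translate :: "r2 \<times> r6 \<Rightarrow> r2 \<times> r6 \<Rightarrow> r2 \<times> r6" where
  "translate l p = (fst l + fst p, G_mult (snd l) (snd p))"

text \<open>The derivative of \<open>translate l\<close>, which is the same at every point.\<close>

definition translate_linear :: "r2 \<times> r6 \<Rightarrow> r2 \<times> r6 \<Rightarrow> r2 \<times> r6" where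
  "translate_linear l p = (let a = crd_y1 l; b = crd_y2 l; s = crd_z1 p; t = crd_z2 p in
    (fst p, (crd_y1 p, crd_y2 p, s, t,
       crd_v1 p + (a - b) * s - (a + 2 * b) * t, crd_v2 p - (2 * a + b) * s + (b - a) * t)))"

definition period_lattice :: "(r2 \<times> r6) set" where
  "period_lattice = Z2 \<times> \<Gamma>"

definition rho :: "r2 \<times> r6 \<Rightarrow> r2 \<times> r6" where
  "rho = map_prod rho_T rho_N"

lemma translate_affine: "translate l = (\<lambda>p. translate_linear l p + l)"
proof
  fix p show "translate l p = translate_linear l p + l"
    by (cases l rule: point_cases; cases p rule: point_cases)
       (simp add: translate_def translate_linear_def algebra_simps)
qed

lemma bounded_linear_translate_linear: "bounded_linear (translate_linear l)"
  unfolding linear_conv_bounded_linear[symmetric] translate_linear_def crd_eq Let_def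
  by (rule linearI) (auto simp: algebra_simps prod_eq_iff)

lemma bounded_linear_rho: "bounded_linear rho"
  unfolding linear_conv_bounded_linear[symmetric]
  by (rule linearI) (auto simp: rho_def algebra_simps)

lemma affine_map_translate: "affine_map (translate l)"
  unfolding affine_map_def translate_affine using bounded_linear_translate_linear by blast

lemma affine_map_rho: "affine_map rho"
  unfolding affine_map_def using bounded_linear_rho by (intro exI[of _ rho] exI[of _ 0]) simp

lemma translate_translate: "translate l (translate m p) = translate (translate l m) p"
  by (cases l rule: point_cases; cases m rule: point_cases; cases p rule: point_cases)
     (simp add: translate_def algebra_simps)

lemma translate_0: "translate 0 p = p"
  by (cases p rule: point_cases) (simp add: translate_def zero_prod_def)

lemma translate_fixed_point: "translate l p = p \<Longrightarrow> l = 0"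
  by (cases l rule: point_cases; cases p rule: point_cases) (auto simp: translate_def zero_prod_def)

lemma rho_translate: "rho (translate l p) = translate (rho l) (rho p)"
  by (cases l rule: point_cases; cases p rule: point_cases)
     (simp add: translate_def rho_def algebra_simps)

lemma rho_cubed: "rho ^^ 3 = id"
  by (auto simp: fun_eq_iff rho_def numeral_3_eq_3)

lemma subgroup_Z2: "subgroup Z2 R2"
proof (rule group.subgroupI[OF group_R2])
  show "Z2 \<subseteq> carrier R2" by (simp add: R2_def)
  have "(of_int 0, of_int 0) \<in> Z2" unfolding Z2_def by blast
  then show "Z2 \<noteq> {}" by blast
  fix x assume "x \<in> Z2"
  then obtain a b :: int where x: "x = (of_int a, of_int b)" by (auto simp: Z2_def)
  have "inv\<^bsub>R2\<^esub> x = - x"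
    by (rule group.inv_equality[OF group_R2]) (auto simp: R2_def)
  also have "\<dots> = (of_int (- a), of_int (- b))" by (simp add: x)
  finally show "inv\<^bsub>R2\<^esub> x \<in> Z2" unfolding Z2_def by blast
  fix y assume "y \<in> Z2"
  then obtain c d :: int where y: "y = (of_int c, of_int d)" by (auto simp: Z2_def)
  have "x \<otimes>\<^bsub>R2\<^esub> y = (of_int (a + c), of_int (b + d))" by (simp add: x y R2_def)
  then show "x \<otimes>\<^bsub>R2\<^esub> y \<in> Z2" unfolding Z2_def by blast
qed

lemma \<Gamma>I: "[c = d] (mod 3) \<Longrightarrow> (of_int a, of_int a', of_int b, of_int b', of_int c, of_int d) \<in> \<Gamma>"
  unfolding \<Gamma>_def by blast

lemma subgroup_\<Gamma>: "subgroup \<Gamma> G"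
proof (rule group.subgroupI[OF group_G])
  show "\<Gamma> \<subseteq> carrier G" by (simp add: G_def)
  show "\<Gamma> \<noteq> {}" using \<Gamma>I[OF cong_refl] by blast
  fix x assume "x \<in> \<Gamma>"
  then obtain a1 a2 b1 b2 c1 c2 :: int where c: "[c1 = c2] (mod 3)"
    and x: "x = (of_int a1, of_int a2, of_int b1, of_int b2, of_int c1, of_int c2)"
    unfolding \<Gamma>_def by blast
  let ?c1 = "- c1 + (a1 - a2) * b1 - (a1 + 2 * a2) * b2"
  let ?c2 = "- c2 - (2 * a1 + a2) * b1 + (a2 - a1) * b2"
  have "inv\<^bsub>G\<^esub> x = (of_int (- a1), of_int (- a2), of_int (- b1), of_int (- b2), of_int ?c1, of_int ?c2)"
    by (rule group.inv_equality[OF group_G]) (auto simp: G_def x zero_prod_def algebra_simps)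
  moreover have "[?c1 = ?c2] (mod 3)"
  proof -
    have "?c1 - ?c2 = (c2 - c1) + 3 * (a1 * b1 - a2 * b2)" by (simp add: algebra_simps)
    moreover have "3 dvd (c2 - c1) + 3 * (a1 * b1 - a2 * b2)"
      using c by (intro dvd_add) (auto simp: cong_iff_dvd_diff dvd_diff_commute)
    ultimately have "3 dvd ?c1 - ?c2" by (simp only:)
    then show ?thesis unfolding cong_iff_dvd_diff .
  qed
  ultimately show "inv\<^bsub>G\<^esub> x \<in> \<Gamma>" using \<Gamma>I by metis
  fix y assume "y \<in> \<Gamma>"
  then obtain a1' a2' b1' b2' c1' c2' :: int where c': "[c1' = c2'] (mod 3)"
    and y: "y = (of_int a1', of_int a2', of_int b1', of_int b2', of_int c1', of_int c2')"
    unfolding \<Gamma>_def by blast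
  let ?d1 = "c1' + c1 + (a1 - a2) * b1' - (a1 + 2 * a2) * b2'"
  let ?d2 = "c2' + c2 - (2 * a1 + a2) * b1' + (a2 - a1) * b2'"
  have "x \<otimes>\<^bsub>G\<^esub> y = (of_int (a1' + a1), of_int (a2' + a2), of_int (b1' + b1), of_int (b2' + b2),
      of_int ?d1, of_int ?d2)"
    by (simp add: G_def x y)
  moreover have "[?d1 = ?d2] (mod 3)"
  proof -
    have "?d1 - ?d2 = (c1' - c2') + ((c1 - c2) + 3 * (a1 * b1' - a2 * b2'))" by (simp add: algebra_simps)
    moreover have "3 dvd (c1' - c2') + ((c1 - c2) + 3 * (a1 * b1' - a2 * b2'))"
      using c c' by (intro dvd_add) (auto simp: cong_iff_dvd_diff)
    ultimately have "3 dvd ?d1 - ?d2" by (simp only:)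
    then show ?thesis unfolding cong_iff_dvd_diff .
  qed
  ultimately show "x \<otimes>\<^bsub>G\<^esub> y \<in> \<Gamma>" using \<Gamma>I by metis
qed

lemma rho_T_hom: "rho_T \<in> hom R2 R2"
  by (auto simp: hom_def R2_def)

lemma rho_N_hom: "rho_N \<in> hom G G"
  by (auto simp: hom_def G_def algebra_simps)

lemma rho_T_Z2: "rho_T ` Z2 = Z2"
proof -
  have sub: "rho_T x \<in> Z2" if "x \<in> Z2" for x
  proof -
    obtain a b :: int where "x = (of_int a, of_int b)" using \<open>x \<in> Z2\<close> by (auto simp: Z2_def)
    then have "rho_T x = (of_int (- a - b), of_int a)" by simp
    then show ?thesis unfolding Z2_def by blast
  qed
  have cube: "x = rho_T (rho_T (rho_T x))" for x by (cases x) simp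
  have "x \<in> rho_T ` Z2" if "x \<in> Z2" for x
    by (rule image_eqI[of x rho_T "rho_T (rho_T x)", OF cube]) (intro sub that)
  then show ?thesis using sub by blast
qed

lemma rho_N_\<Gamma>: "rho_N ` \<Gamma> = \<Gamma>"
proof -
  have sub: "rho_N x \<in> \<Gamma>" if "x \<in> \<Gamma>" for x
  proof -
    obtain a1 a2 b1 b2 c1 c2 :: int where c: "[c1 = c2] (mod 3)"
      and x: "x = (of_int a1, of_int a2, of_int b1, of_int b2, of_int c1, of_int c2)"
      using \<open>x \<in> \<Gamma>\<close> unfolding \<Gamma>_def by blast
    have "- c1 - c2 - c1 = (c1 - c2) + 3 * (- c1)" by simp
    moreover have "3 dvd (c1 - c2) + 3 * (- c1)" using c by (intro dvd_add) (auto simp: cong_iff_dvd_diff)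
    ultimately have "[- c1 - c2 = c1] (mod 3)" by (simp add: cong_iff_dvd_diff)
    moreover have "rho_N x = (of_int (- a1 - a2), of_int a1, of_int (- b1 - b2), of_int b1,
        of_int (- c1 - c2), of_int c1)"
      by (simp add: x)
    ultimately show ?thesis using \<Gamma>I by metis
  qed
  have cube: "x = rho_N (rho_N (rho_N x))" for x by (cases x) simp
  have "x \<in> rho_N ` \<Gamma>" if "x \<in> \<Gamma>" for x
    by (rule image_eqI[of x rho_N "rho_N (rho_N x)", OF cube]) (intro sub that)
  then show ?thesis using sub by blast
qed

lemma translate_eq_mult: "translate l p = (fst l \<otimes>\<^bsub>R2\<^esub> fst p, snd l \<otimes>\<^bsub>G\<^esub> snd p)"
  by (simp add: translate_def R2_def G_def)

lemma proj_M_eq_iff: "proj_M x = proj_M y \<longleftrightarrow> (\<exists>l\<in>period_lattice. translate l x = y)"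
proof -
  have "proj_M x = proj_M y \<longleftrightarrow> Z2 #>\<^bsub>R2\<^esub> fst x = Z2 #>\<^bsub>R2\<^esub> fst y \<and> \<Gamma> #>\<^bsub>G\<^esub> snd x = \<Gamma> #>\<^bsub>G\<^esub> snd y"
    by (cases x; cases y) (simp add: proj_M_def)
  also have "\<dots> \<longleftrightarrow> (\<exists>a\<in>Z2. a \<otimes>\<^bsub>R2\<^esub> fst x = fst y) \<and> (\<exists>g\<in>\<Gamma>. g \<otimes>\<^bsub>G\<^esub> snd x = snd y)"
    using group.coset_eq_iff_orbit[OF group_R2 subgroup_Z2, of "fst x" "fst y"]
      group.coset_eq_iff_orbit[OF group_G subgroup_\<Gamma>, of "snd x" "snd y"]
    by (simp add: R2_def G_def)
  also have "\<dots> \<longleftrightarrow> (\<exists>l\<in>period_lattice. translate l x = y)"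
    by (cases y) (auto simp: translate_eq_mult period_lattice_def)
  finally show ?thesis .
qed

lemma proj_M_rho: "rho_M (proj_M x) = proj_M (rho x)"
  using group.image_coset[OF group_R2 rho_T_hom subgroup_Z2 rho_T_Z2, of "fst x"]
    group.image_coset[OF group_G rho_N_hom subgroup_\<Gamma> rho_N_\<Gamma>, of "snd x"]
  by (cases x) (simp add: rho_M_def proj_M_def rho_def R2_def G_def)

lemma proj_M_rho_funpow: "(rho_M ^^ j) (proj_M x) = proj_M ((rho ^^ j) x)"
  by (induction j) (auto simp: proj_M_rho)

lemma continuous_translation_R2: "continuous_on UNIV (\<lambda>x. a \<otimes>\<^bsub>R2\<^esub> x)"
  by (simp add: R2_def continuous_intros)

lemma continuous_translation_G: "continuous_on UNIV (\<lambda>x. a \<otimes>\<^bsub>G\<^esub> x)"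
proof -
  have "continuous_on UNIV (\<lambda>x. snd (translate (0, a) (0, x)))"
    by (intro continuous_intros continuous_on_compose2[OF smooth_on_imp_continuous_on
        [OF smooth_on_affine_map[OF affine_map_translate[of "(0, a)"], of UNIV]]]) auto
  then show ?thesis by (simp add: translate_def G_def)
qed

lemma quotient_map_proj_M: "quotient_map euclidean M_top proj_M"
proof (rule continuous_open_imp_quotient_map)
  have open_maps: "open_map euclidean T2_top (\<lambda>x. Z2 #>\<^bsub>R2\<^esub> x)" "open_map euclidean N_top (\<lambda>g. \<Gamma> #>\<^bsub>G\<^esub> g)"
    unfolding T2_top_def N_top_def
    using open_map_coset_projection[OF group_R2 subgroup_Z2 _ continuous_translation_R2]
      open_map_coset_projection[OF group_G subgroup_\<Gamma> _ continuous_translation_G]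
    by (simp_all add: R2_def G_def)
  have quot: "quotient_map euclidean T2_top (\<lambda>x. Z2 #>\<^bsub>R2\<^esub> x)" "quotient_map euclidean N_top (\<lambda>g. \<Gamma> #>\<^bsub>G\<^esub> g)"
    unfolding T2_top_def N_top_def by (rule quotient_map_quotient_topology)+
  show "open_map euclidean M_top proj_M"
    using open_map_map_prod[OF open_maps] by (simp add: M_top_def proj_M_def)
  have "continuous_map (prod_topology euclidean euclidean) M_top proj_M"
    unfolding M_top_def proj_M_def map_prod_def case_prod_unfold
    using quot[THEN quotient_imp_continuous_map]
    by (intro continuous_map_pairedI continuous_map_compose[OF continuous_map_fst, unfolded comp_def]
        continuous_map_compose[OF continuous_map_snd, unfolded comp_def])
  then show "continuous_map euclidean M_top proj_M" by simp
  have "range (\<lambda>x. Z2 #>\<^bsub>R2\<^esub> x) = topspace T2_top" "range (\<lambda>g. \<Gamma> #>\<^bsub>G\<^esub> g) = topspace N_top"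
    using quot[THEN quotient_imp_surjective_map] by simp_all
  then show "proj_M ` topspace euclidean = topspace M_top"
    by (simp add: M_top_def proj_M_def map_prod_surj_on flip: UNIV_Times_UNIV)
qed

definition lattice_translations :: "(r2 \<times> r6 \<Rightarrow> r2 \<times> r6) set" where
  "lattice_translations = translate ` period_lattice"

text \<open>The group generated by the lattice translations and \<open>rho\<close>, a semidirect product with \<open>\<int>\<^sub>3\<close>.
  The exponent is an arbitrary natural number, which makes the product of two elements have the
  required shape without reduction modulo 3.\<close>

definition deck :: "(r2 \<times> r6 \<Rightarrow> r2 \<times> r6) set" where
  "deck = {translate l \<circ> rho ^^ j | l j. l \<in> period_lattice}"

lemma zero_lattice: "0 \<in> period_lattice"
  using subgroup.one_closed[OF subgroup_Z2] subgroup.one_closed[OF subgroup_\<Gamma>]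
  by (simp add: period_lattice_def zero_prod_def R2_def G_def)

lemma translate_lattice: "l \<in> period_lattice \<Longrightarrow> m \<in> period_lattice \<Longrightarrow> translate l m \<in> period_lattice"
  using subgroup.m_closed[OF subgroup_Z2] subgroup.m_closed[OF subgroup_\<Gamma>]
  by (auto simp: period_lattice_def translate_eq_mult)

lemma inverse_lattice:
  assumes "l \<in> period_lattice" shows "\<exists>m\<in>period_lattice. translate m l = 0"
proof
  let ?m = "(inv\<^bsub>R2\<^esub> (fst l), inv\<^bsub>G\<^esub> (snd l))"
  show "?m \<in> period_lattice"
    using assms subgroup.m_inv_closed[OF subgroup_Z2] subgroup.m_inv_closed[OF subgroup_\<Gamma>]
    by (auto simp: period_lattice_def)
  show "translate ?m l = 0"
    using group.l_inv[OF group_R2, of "fst l"] group.l_inv[OF group_G, of "snd l"]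
    by (simp add: translate_eq_mult) (simp add: R2_def G_def zero_prod_def)
qed

lemma rho_lattice: "l \<in> period_lattice \<Longrightarrow> (rho ^^ j) l \<in> period_lattice"
proof (induction j)
  case (Suc j)
  have "rho (a, g) \<in> period_lattice" if "a \<in> Z2" "g \<in> \<Gamma>" for a g
    using imageI[OF that(1), of rho_T] imageI[OF that(2), of rho_N]
    by (simp add: rho_T_Z2 rho_N_\<Gamma> period_lattice_def rho_def)
  then have "rho m \<in> period_lattice" if "m \<in> period_lattice" for m
    using that unfolding period_lattice_def by blast
  then show ?case using Suc by simp
qed simp

lemma rho_funpow_translate: "(rho ^^ j) (translate l p) = translate ((rho ^^ j) l) ((rho ^^ j) p)"
  by (induction j) (auto simp: rho_translate)

lemma rho_funpow_mult_3: "rho ^^ (3 * j) = id"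
  by (simp add: funpow_mult rho_cubed flip: funpow_mult)

lemma lattice_translations_subset_deck: "lattice_translations \<subseteq> deck"
proof
  fix g assume "g \<in> lattice_translations"
  then obtain l where "l \<in> period_lattice" "g = translate l \<circ> rho ^^ 0" by (auto simp: lattice_translations_def)
  then show "g \<in> deck" unfolding deck_def by blast
qed

lemma deck_compose:
  assumes "g \<in> deck" "h \<in> deck" shows "g \<circ> h \<in> deck"
proof -
  obtain l i m j where g: "l \<in> period_lattice" "g = translate l \<circ> rho ^^ i"
    and h: "m \<in> period_lattice" "h = translate m \<circ> rho ^^ j"
    using assms unfolding deck_def by blast
  have "g \<circ> h = translate (translate l ((rho ^^ i) m)) \<circ> rho ^^ (i + j)"
    by (auto simp: fun_eq_iff g h rho_funpow_translate translate_translate funpow_add)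
  then show ?thesis
    unfolding deck_def using translate_lattice[OF g(1) rho_lattice[OF h(1)]] by blast
qed

lemma rho_deck: "rho ^^ j \<in> deck"
proof -
  have "rho ^^ j = translate 0 \<circ> rho ^^ j" by (auto simp: fun_eq_iff translate_0)
  then show ?thesis unfolding deck_def using zero_lattice by blast
qed

lemma translations_left_inverse:
  assumes "g \<in> lattice_translations" shows "\<exists>h\<in>lattice_translations. h \<circ> g = id"
proof -
  obtain l where l: "l \<in> period_lattice" "g = translate l" using assms by (auto simp: lattice_translations_def)
  obtain m where "m \<in> period_lattice" "translate m l = 0" using inverse_lattice[OF l(1)] by blast
  then have "translate m \<in> lattice_translations" "translate m \<circ> g = id"
    by (auto simp: lattice_translations_def fun_eq_iff l(2) translate_translate translate_0)
  then show ?thesis by blast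
qed

lemma deck_left_inverse:
  assumes "g \<in> deck" shows "\<exists>h\<in>deck. h \<circ> g = id"
proof -
  obtain l j where l: "l \<in> period_lattice" "g = translate l \<circ> rho ^^ j" using assms unfolding deck_def by blast
  obtain h where h: "h \<in> lattice_translations" "h \<circ> translate l = id"
    using translations_left_inverse l(1) unfolding lattice_translations_def by blast
  (* rho ^^ (2 * j) inverts rho ^^ j because rho has order 3 *)
  have "(rho ^^ (2 * j) \<circ> h) \<circ> g = rho ^^ (2 * j) \<circ> (h \<circ> translate l) \<circ> rho ^^ j"
    by (simp add: l(2) comp_assoc)
  also have "\<dots> = rho ^^ (3 * j)" using h(2) by (simp flip: funpow_add)
  finally have "(rho ^^ (2 * j) \<circ> h) \<circ> g = id" by (simp add: rho_funpow_mult_3)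
  then show ?thesis using deck_compose[OF rho_deck] h(1) lattice_translations_subset_deck by blast
qed

lemma affine_map_deck: "g \<in> deck \<Longrightarrow> affine_map g"
  unfolding deck_def using affine_map_compose affine_map_translate affine_map_funpow affine_map_rho by blast

lemma integral_coordinates_Pair:
  "(\<forall>b\<in>Basis. (x, y) \<bullet> b \<in> \<int>) \<longleftrightarrow> (\<forall>b\<in>Basis. x \<bullet> b \<in> \<int>) \<and> (\<forall>b\<in>Basis. y \<bullet> b \<in> \<int>)"
  unfolding Basis_prod_def by (simp add: ball_Un)

lemma integral_coordinates_lattice:
  assumes "p \<in> period_lattice" shows "\<forall>b\<in>Basis. p \<bullet> b \<in> \<int>"
proof -
  obtain a b a1 a2 b1 b2 c1 c2 :: int where p: "p = ((of_int a, of_int b),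
      (of_int a1, of_int a2, of_int b1, of_int b2, of_int c1, of_int c2))"
    using assms unfolding period_lattice_def Z2_def \<Gamma>_def by blast
  show ?thesis unfolding p integral_coordinates_Pair by simp
qed

text \<open>The product of \<open>q\<close> and the inverse of \<open>p\<close>, that is, the unique \<open>l\<close> with \<open>translate l p = q\<close>.\<close>

definition right_quotient :: "r2 \<times> r6 \<Rightarrow> r2 \<times> r6 \<Rightarrow> r2 \<times> r6" where
  "right_quotient q p = (let a = crd_y1 q - crd_y1 p; b = crd_y2 q - crd_y2 p;
      s = crd_z1 p; t = crd_z2 p in
    (fst q - fst p, (a, b, crd_z1 q - s, crd_z2 q - t,
      crd_v1 q - crd_v1 p - (a - b) * s + (a + 2 * b) * t,
      crd_v2 q - crd_v2 p + (2 * a + b) * s - (b - a) * t)))"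

lemma right_quotient_translate: "right_quotient (translate l p) p = l"
  by (cases l rule: point_cases; cases p rule: point_cases)
     (simp add: right_quotient_def translate_def)

text \<open>The translations carrying a point of \<open>K\<close> into \<open>L\<close> form a compact set of quotients \<open>q p\<^sup>-\<^sup>1\<close>, which
  contains only finitely many integral points.\<close>

lemma finite_lattice_meeting:
  assumes "compact K" "compact L" shows "finite {l \<in> period_lattice. translate l ` K \<inter> L \<noteq> {}}"
proof -
  let ?B = "(\<lambda>z. right_quotient (fst z) (snd z)) ` (L \<times> K)"
  have "compact ?B"
    unfolding right_quotient_def crd_eq Let_def
    by (intro compact_continuous_image compact_Times assms continuous_intros)
  then have "finite {p \<in> ?B. \<forall>b\<in>Basis. p \<bullet> b \<in> \<int>}"
    by (intro finite_bounded_integral_points compact_imp_bounded)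
  moreover have "{l \<in> period_lattice. translate l ` K \<inter> L \<noteq> {}} \<subseteq> {p \<in> ?B. \<forall>b\<in>Basis. p \<bullet> b \<in> \<int>}"
  proof
    fix l assume "l \<in> {l \<in> period_lattice. translate l ` K \<inter> L \<noteq> {}}"
    then obtain p where l: "l \<in> period_lattice" "p \<in> K" "translate l p \<in> L" by blast
    then have "l \<in> ?B"
      by (intro image_eqI[of _ _ "(translate l p, p)"]) (simp_all add: right_quotient_translate)
    then show "l \<in> {p \<in> ?B. \<forall>b\<in>Basis. p \<bullet> b \<in> \<int>}"
      using integral_coordinates_lattice[OF l(1)] by blast
  qed
  ultimately show ?thesis by (rule rev_finite_subset)
qed

text \<open>The three cosets of the lattice are treated separately, moving \<open>K\<close> by the power of \<open>rho\<close>.\<close>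

lemma deck_proper:
  assumes "compact K" shows "finite {g \<in> deck. g ` K \<inter> K \<noteq> {}}"
proof (rule finite_subset)
  let ?L = "\<lambda>j. {l \<in> period_lattice. translate l ` ((rho ^^ j) ` K) \<inter> K \<noteq> {}}"
  show "{g \<in> deck. g ` K \<inter> K \<noteq> {}} \<subseteq> (\<Union>j<3. (\<lambda>l. translate l \<circ> rho ^^ j) ` ?L j)"
  proof
    fix g assume "g \<in> {g \<in> deck. g ` K \<inter> K \<noteq> {}}"
    then obtain l j where l: "l \<in> period_lattice" "g = translate l \<circ> rho ^^ j" and g: "g ` K \<inter> K \<noteq> {}"
      unfolding deck_def by blast
    have "rho ^^ j = rho ^^ (j mod 3 + 3 * (j div 3))" by simp
    then have "rho ^^ j = rho ^^ (j mod 3)"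
      by (metis comp_id funpow_add rho_funpow_mult_3)
    then have "g = translate l \<circ> rho ^^ (j mod 3)" using l(2) by simp
    moreover from this g l(1) have "l \<in> ?L (j mod 3)" by (simp add: image_comp)
    ultimately show "g \<in> (\<Union>j<3. (\<lambda>l. translate l \<circ> rho ^^ j) ` ?L j)" by force
  qed
  have "compact ((rho ^^ j) ` K)" for j
    using smooth_on_imp_continuous_on[OF smooth_on_affine_map[OF affine_map_funpow[OF affine_map_rho]]] assms
    by (rule compact_continuous_image)
  then show "finite (\<Union>j<3. (\<lambda>l. translate l \<circ> rho ^^ j) ` ?L j)"
    using finite_lattice_meeting[OF _ assms] by blast
qed

interpretation M: discrete_smooth_action lattice_translations M_top proj_M
proof
  show "id \<in> lattice_translations"
    using zero_lattice translate_0 by (auto simp: lattice_translations_def fun_eq_iff intro!: image_eqI[of _ _ 0])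
  show "g \<circ> h \<in> lattice_translations" if gh: "g \<in> lattice_translations" "h \<in> lattice_translations" for g h
  proof -
    obtain l m where lm: "l \<in> period_lattice" "m \<in> period_lattice" "g = translate l" "h = translate m"
      using gh by (auto simp: lattice_translations_def)
    have "(g \<circ> h) p = translate (translate l m) p" for p
      by (simp only: lm comp_apply translate_translate)
    then have "g \<circ> h = translate (translate l m)" by (rule ext)
    then show ?thesis using translate_lattice lm by (auto simp: lattice_translations_def)
  qed
  show "\<exists>h\<in>lattice_translations. h \<circ> g = id" if "g \<in> lattice_translations" for g
    using translations_left_inverse that by blast
  show "smooth_on UNIV g" if "g \<in> lattice_translations" for g
    using affine_map_deck lattice_translations_subset_deck that
    by (intro smooth_on_affine_map) blast
  show "finite {g \<in> lattice_translations. g ` K \<inter> K \<noteq> {}}" if "compact K" for K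
    by (rule finite_subset[OF _ deck_proper[OF that]]) (use lattice_translations_subset_deck in blast)
  show "quotient_map euclidean M_top proj_M" by (rule quotient_map_proj_M)
  show "proj_M x = proj_M y \<longleftrightarrow> (\<exists>g\<in>lattice_translations. g x = y)" for x y
    by (simp add: proj_M_eq_iff lattice_translations_def)
qed

lemma proj_Mhat_proj_M: "proj_Mhat (proj_M x) = {proj_M ((rho ^^ j) x) | j. True}"
  by (simp add: proj_Mhat_def proj_M_rho_funpow)

lemma proj_Mhat_subset:
  assumes "proj_M y = proj_M ((rho ^^ j) x)" shows "proj_Mhat (proj_M y) \<subseteq> proj_Mhat (proj_M x)"
proof
  fix m assume "m \<in> proj_Mhat (proj_M y)"
  then obtain i where "m = (rho_M ^^ i) (proj_M y)" by (auto simp: proj_Mhat_def)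
  then have "m = proj_M ((rho ^^ (i + j)) x)" by (simp add: assms proj_M_rho_funpow funpow_add)
  then show "m \<in> proj_Mhat (proj_M x)" by (auto simp: proj_Mhat_proj_M)
qed

text \<open>That deck transformations identify points in the quotient uses \<open>rho ^^ (2 * j)\<close> as the inverse of
  \<open>rho ^^ j\<close>: orbits of \<open>rho_M\<close> are formed with nonnegative exponents only.\<close>

lemma proj_Mhat_eq_iff:
  "(proj_Mhat \<circ> proj_M) x = (proj_Mhat \<circ> proj_M) y \<longleftrightarrow> (\<exists>g\<in>deck. g x = y)"
proof
  assume "(proj_Mhat \<circ> proj_M) x = (proj_Mhat \<circ> proj_M) y"
  moreover have "proj_M ((rho ^^ 0) y) \<in> proj_Mhat (proj_M y)" unfolding proj_Mhat_proj_M by blast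
  ultimately have "proj_M y \<in> proj_Mhat (proj_M x)" by simp
  then obtain j where "proj_M ((rho ^^ j) x) = proj_M y" unfolding proj_Mhat_proj_M by force
  then obtain l where "l \<in> period_lattice" "translate l ((rho ^^ j) x) = y" using proj_M_eq_iff by blast
  then show "\<exists>g\<in>deck. g x = y"
    unfolding deck_def by (intro bexI[of _ "translate l \<circ> rho ^^ j"]) (simp, blast)
next
  assume "\<exists>g\<in>deck. g x = y"
  then obtain l j where l: "l \<in> period_lattice" "y = translate l ((rho ^^ j) x)" by (auto simp: deck_def)
  then have y: "proj_M ((rho ^^ j) x) = proj_M y" using proj_M_eq_iff by blast
  have "proj_M ((rho ^^ (2 * j)) y) = (rho_M ^^ (2 * j)) (proj_M ((rho ^^ j) x))"
    by (simp add: y proj_M_rho_funpow)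
  also have "\<dots> = proj_M ((rho ^^ (2 * j + j)) x)"
    by (simp only: proj_M_rho_funpow funpow_add comp_apply)
  also have "\<dots> = proj_M x" using rho_funpow_mult_3[of j] by simp
  finally show "(proj_Mhat \<circ> proj_M) x = (proj_Mhat \<circ> proj_M) y"
    using proj_Mhat_subset[of y j x] proj_Mhat_subset[of x "2 * j" y] y by auto
qed

interpretation Mhat: discrete_smooth_action deck Mhat_top "proj_Mhat \<circ> proj_M"
proof
  show "id \<in> deck" using rho_deck[of 0] by simp
  show "quotient_map euclidean Mhat_top (proj_Mhat \<circ> proj_M)"
    unfolding Mhat_top_def using quotient_map_proj_M quotient_map_quotient_topology
    by (rule quotient_map_compose)
  show "smooth_on UNIV g" if "g \<in> deck" for g
    using affine_map_deck[OF that] by (rule smooth_on_affine_map)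
qed (fact deck_compose deck_left_inverse deck_proper proj_Mhat_eq_iff)+

section \<open>Closedness, nondegeneracy and invariance of the 2-form\<close>

lemma bounded_linear_crd:
  "bounded_linear crd_x1" "bounded_linear crd_x2" "bounded_linear crd_y1" "bounded_linear crd_y2"
  "bounded_linear crd_z1" "bounded_linear crd_z2" "bounded_linear crd_v1" "bounded_linear crd_v2"
  unfolding crd_eq
  by (intro bounded_linear_fst_comp bounded_linear_snd_comp bounded_linear_ident)+

lemma df_linear:
  assumes "bounded_linear f" shows "df f x [v] = f v"
  using frechet_derivative_affine[OF assms, of 0] by (simp add: df_def ext_deriv_def)

lemmas df_crd = bounded_linear_crd[THEN df_linear]

definition \<eta>\<^sub>1_value :: "r2 \<times> r6 \<Rightarrow> r2 \<times> r6 \<Rightarrow> real" where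
  "\<eta>\<^sub>1_value p u =
    crd_v1 u - (crd_y1 p - crd_y2 p) * crd_z1 u + (crd_y1 p + 2 * crd_y2 p) * crd_z2 u"

definition \<eta>\<^sub>2_value :: "r2 \<times> r6 \<Rightarrow> r2 \<times> r6 \<Rightarrow> real" where
  "\<eta>\<^sub>2_value p u =
    crd_v2 u + (2 * crd_y1 p + crd_y2 p) * crd_z1 u + (crd_y1 p - crd_y2 p) * crd_z2 u"

definition \<omega>_value :: "r2 \<times> r6 \<Rightarrow> r2 \<times> r6 \<Rightarrow> r2 \<times> r6 \<Rightarrow> real" where
  "\<omega>_value p u v =
    crd_x1 u * crd_x2 v - crd_x1 v * crd_x2 u
    + \<eta>\<^sub>2_value p u * crd_y1 v - \<eta>\<^sub>2_value p v * crd_y1 u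
    - (\<eta>\<^sub>1_value p u * crd_y2 v - \<eta>\<^sub>1_value p v * crd_y2 u)
    + crd_z1 u * crd_z2 v - crd_z1 v * crd_z2 u"

lemmas \<omega>_value_defs = \<omega>_value_def \<eta>\<^sub>1_value_def \<eta>\<^sub>2_value_def

lemma \<omega>_pair: "\<omega> p [u, v] = \<omega>_value p u v"
  unfolding \<omega>_def \<omega>_value_defs wedge11_apply \<alpha>\<^sub>1_def \<alpha>\<^sub>2_def \<beta>\<^sub>1_def \<beta>\<^sub>2_def \<gamma>\<^sub>1_def \<gamma>\<^sub>2_def
    \<eta>\<^sub>1_def \<eta>\<^sub>2_def df_crd
  by algebra

text \<open>The part of \<open>\<omega>\<close> that depends on the base point; it is linear in that point, and so it is the
  directional derivative of \<open>\<omega>\<close> along \<open>w\<close>.\<close>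

definition \<omega>_slope :: "r2 \<times> r6 \<Rightarrow> r2 \<times> r6 \<Rightarrow> r2 \<times> r6 \<Rightarrow> real" where
  "\<omega>_slope w u v =
    ((2 * crd_y1 w + crd_y2 w) * crd_z1 u + (crd_y1 w - crd_y2 w) * crd_z2 u) * crd_y1 v
    - ((2 * crd_y1 w + crd_y2 w) * crd_z1 v + (crd_y1 w - crd_y2 w) * crd_z2 v) * crd_y1 u
    + ((crd_y1 w - crd_y2 w) * crd_z1 u - (crd_y1 w + 2 * crd_y2 w) * crd_z2 u) * crd_y2 v
    - ((crd_y1 w - crd_y2 w) * crd_z1 v - (crd_y1 w + 2 * crd_y2 w) * crd_z2 v) * crd_y2 u"

lemma \<omega>_affine: "\<omega> p [u, v] = \<omega>_slope p u v + \<omega>_value 0 u v"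
  unfolding \<omega>_pair \<omega>_value_defs \<omega>_slope_def by (simp add: crd_eq algebra_simps)

lemma bounded_linear_\<omega>_slope: "bounded_linear (\<lambda>w. \<omega>_slope w u v)"
  unfolding \<omega>_slope_def linear_conv_bounded_linear[symmetric] crd_eq
  by (rule linearI) (simp_all add: algebra_simps)

lemma frechet_derivative_\<omega>: "frechet_derivative (\<lambda>p. \<omega> p [u, v]) (at x) w = \<omega>_slope w u v"
  using frechet_derivative_affine[OF bounded_linear_\<omega>_slope[of u v], of "\<omega>_value 0 u v"]
  by (simp add: \<omega>_affine)

lemma length_2_obtain:
  assumes "length vs = 2" obtains u v where "vs = [u, v]"
  using assms by (auto simp: numeral_2_eq_2 length_Suc_conv)

lemma alternating_\<omega>: "alternating_multilinear 2 (\<omega> x)"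
  unfolding alternating_multilinear_def
proof (intro allI impI conjI)
  fix vs :: "(r2 \<times> r6) list" and i j :: nat
  assume "length vs = 2"
  then obtain a b where vs: "vs = [a, b]" by (rule length_2_obtain)
  have lin: "linear (\<lambda>v. \<omega>_value x v b)" "linear (\<lambda>v. \<omega>_value x a v)"
    unfolding \<omega>_value_defs crd_eq by (rule linearI; simp add: algebra_simps)+
  show "linear (\<lambda>v. \<omega> x (vs[i := v]))" if "i < 2"
    using that lin by (auto simp: vs \<omega>_pair less_2_cases_iff)
  assume "i < 2" "j < 2" "i \<noteq> j \<and> vs ! i = vs ! j"
  then have "a = b" by (auto simp: vs less_2_cases_iff)
  then show "\<omega> x vs = 0" by (simp add: vs \<omega>_pair \<omega>_value_defs)
qed

lemma smooth_form_\<omega>: "smooth_form 2 U \<omega>"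
  unfolding smooth_form_def
proof (intro conjI ballI allI impI)
  fix vs :: "(r2 \<times> r6) list" assume "length vs = 2"
  then obtain a b where vs: "vs = [a, b]" by (rule length_2_obtain)
  show "smooth_on U (\<lambda>x. \<omega> x vs)"
    unfolding vs \<omega>_affine using smooth_on_affine[OF bounded_linear_\<omega>_slope] .
qed (rule alternating_\<omega>)

text \<open>The alternating sum of the slopes is the cubic identity
  \<open>d\<eta>\<^sub>2 \<and> \<beta>\<^sub>1 = d\<eta>\<^sub>1 \<and> \<beta>\<^sub>2\<close> in coordinates.\<close>

lemma \<omega>_closed:
  assumes "length vs = 3" shows "ext_deriv 2 \<omega> x vs = 0"
proof -
  obtain a b c where vs: "vs = [a, b, c]"
    using assms by (auto simp: numeral_3_eq_3 length_Suc_conv)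
  have "ext_deriv 2 \<omega> x vs = \<omega>_slope a b c - \<omega>_slope b a c + \<omega>_slope c a b"
    by (simp add: ext_deriv_def vs numeral_2_eq_2 frechet_derivative_\<omega>)
  also have "\<dots> = 0" unfolding \<omega>_slope_def by algebra
  finally show ?thesis .
qed

text \<open>The frame dual to \<open>\<alpha>\<^sub>1, \<alpha>\<^sub>2, \<eta>\<^sub>2, \<beta>\<^sub>1, \<beta>\<^sub>2, \<eta>\<^sub>1, \<gamma>\<^sub>1, \<gamma>\<^sub>2\<close>, in the order that makes conjugate
  vectors adjacent. The last two vectors are the coordinate fields of \<open>z\<^sub>1, z\<^sub>2\<close> corrected so that
  \<open>\<eta>\<^sub>1\<close> and \<open>\<eta>\<^sub>2\<close> vanish on them.\<close>

definition symplectic_frame :: "r2 \<times> r6 \<Rightarrow> (r2 \<times> r6) list" where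
  "symplectic_frame p = (let a = crd_y1 p; b = crd_y2 p in
    [((1, 0), 0), ((0, 1), 0),
     (0, (0, 0, 0, 0, 0, 1)), (0, (1, 0, 0, 0, 0, 0)),
     (0, (0, 1, 0, 0, 0, 0)), (0, (0, 0, 0, 0, 1, 0)),
     (0, (0, 0, 1, 0, a - b, - (2 * a + b))), (0, (0, 0, 0, 1, - (a + 2 * b), b - a))])"

lemma \<omega>_symplectic_frame:
  assumes "i < j" "j < 8"
  shows "\<omega> p [symplectic_frame p ! i, symplectic_frame p ! j] = (if even i \<and> j = Suc i then 1 else 0)"
proof -
  have "j \<in> {0,1,2,3,4,5,6,7}" "i \<in> {0,1,2,3,4,5,6}" using assms by auto
  then show ?thesis
    using assms(1)
    by (elim insertE emptyE; simp add: symplectic_frame_def Let_def \<omega>_pair \<omega>_value_defs crd_eq)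
qed

lemma \<omega>_nondegenerate: "wedge_power \<omega> 4 p (symplectic_frame p) \<noteq> 0"
proof -
  have "wedge_power \<omega> 4 p (symplectic_frame p) = fact 4"
    by (rule wedge_power_symplectic_frame)
       (use \<omega>_symplectic_frame in \<open>auto simp: symplectic_frame_def Let_def\<close>)
  then show ?thesis by simp
qed

lemma crd_translate_linear:
  "crd_x1 (translate_linear l u) = crd_x1 u" "crd_x2 (translate_linear l u) = crd_x2 u"
  "crd_y1 (translate_linear l u) = crd_y1 u" "crd_y2 (translate_linear l u) = crd_y2 u"
  "crd_z1 (translate_linear l u) = crd_z1 u" "crd_z2 (translate_linear l u) = crd_z2 u"
  "crd_v1 (translate_linear l u) =
    crd_v1 u + (crd_y1 l - crd_y2 l) * crd_z1 u - (crd_y1 l + 2 * crd_y2 l) * crd_z2 u"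
  "crd_v2 (translate_linear l u) =
    crd_v2 u - (2 * crd_y1 l + crd_y2 l) * crd_z1 u + (crd_y2 l - crd_y1 l) * crd_z2 u"
  by (simp_all add: translate_linear_def Let_def crd_eq)

lemma crd_y_translate:
  "crd_y1 (translate l p) = crd_y1 l + crd_y1 p" "crd_y2 (translate l p) = crd_y2 l + crd_y2 p"
  by (cases l rule: point_cases; cases p rule: point_cases; simp add: translate_def)+

lemma crd_rho:
  "crd_x1 (rho u) = - crd_x1 u - crd_x2 u" "crd_x2 (rho u) = crd_x1 u"
  "crd_y1 (rho u) = - crd_y1 u - crd_y2 u" "crd_y2 (rho u) = crd_y1 u"
  "crd_z1 (rho u) = - crd_z1 u - crd_z2 u" "crd_z2 (rho u) = crd_z1 u"
  "crd_v1 (rho u) = - crd_v1 u - crd_v2 u" "crd_v2 (rho u) = crd_v1 u"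
  by (cases u rule: point_cases; simp add: rho_def)+

text \<open>This is the left invariance of \<open>\<eta>\<^sub>1\<close> and \<open>\<eta>\<^sub>2\<close>.\<close>

lemma \<eta>_value_translate:
  "\<eta>\<^sub>1_value (translate l p) (translate_linear l u) = \<eta>\<^sub>1_value p u"
  "\<eta>\<^sub>2_value (translate l p) (translate_linear l u) = \<eta>\<^sub>2_value p u"
  unfolding \<eta>\<^sub>1_value_def \<eta>\<^sub>2_value_def crd_translate_linear crd_y_translate
  by (simp_all add: algebra_simps)

lemma \<eta>_value_rho:
  "\<eta>\<^sub>1_value (rho p) (rho u) = - \<eta>\<^sub>1_value p u - \<eta>\<^sub>2_value p u"
  "\<eta>\<^sub>2_value (rho p) (rho u) = \<eta>\<^sub>1_value p u"
  unfolding \<eta>\<^sub>1_value_def \<eta>\<^sub>2_value_def crd_rho by (simp_all add: algebra_simps)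

lemma pullback_translate_\<omega>:
  assumes "length vs = 2" shows "pullback (translate l) \<omega> x vs = \<omega> x vs"
proof -
  obtain u v where vs: "vs = [u, v]" using assms by (rule length_2_obtain)
  have "frechet_derivative (translate l) (at x) = translate_linear l"
    unfolding translate_affine by (rule frechet_derivative_affine[OF bounded_linear_translate_linear])
  then have "pullback (translate l) \<omega> x vs
      = \<omega>_value (translate l x) (translate_linear l u) (translate_linear l v)"
    by (simp add: pullback_def vs \<omega>_pair)
  also have "\<dots> = \<omega>_value x u v"
    by (simp add: \<omega>_value_def \<eta>_value_translate crd_translate_linear)
  finally show ?thesis by (simp add: vs \<omega>_pair)
qed

text \<open>On each of the pairs \<open>(\<alpha>\<^sub>1, \<alpha>\<^sub>2)\<close>, \<open>(\<beta>\<^sub>1, \<beta>\<^sub>2)\<close>, \<open>(\<gamma>\<^sub>1, \<gamma>\<^sub>2)\<close>, \<open>(\<eta>\<^sub>1, \<eta>\<^sub>2)\<close> the pullback by \<open>rho\<close>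
  acts by the same matrix of determinant 1, and \<open>\<omega>\<close> is built from determinants:
  \<open>\<eta>\<^sub>2 \<and> \<beta>\<^sub>1 - \<eta>\<^sub>1 \<and> \<beta>\<^sub>2\<close> is, up to sign, the polarised determinant of the \<open>\<eta>\<close> and \<open>\<beta>\<close> pairs.\<close>

lemma pullback_rho_\<omega>:
  assumes "length vs = 2" shows "pullback rho \<omega> x vs = \<omega> x vs"
proof -
  obtain u v where vs: "vs = [u, v]" using assms by (rule length_2_obtain)
  have "frechet_derivative rho (at x) = rho"
    using frechet_derivative_affine[OF bounded_linear_rho, of 0] by simp
  then have "pullback rho \<omega> x vs = \<omega>_value (rho x) (rho u) (rho v)"
    by (simp add: pullback_def vs \<omega>_pair)
  also have "\<dots> = \<omega>_value x u v"
    unfolding \<omega>_value_def \<eta>_value_rho crd_rho by (simp add: algebra_simps)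
  finally show ?thesis by (simp add: vs \<omega>_pair)
qed

lemma pullback_deck_\<omega>:
  assumes "g \<in> deck" "length vs = 2" shows "pullback g \<omega> x vs = \<omega> x vs"
proof -
  have rho: "pullback (rho ^^ j) \<omega> x vs = \<omega> x vs" if "length vs = 2" for j x vs
    using that
  proof (induction j arbitrary: x vs)
    case 0
    then show ?case by (simp add: pullback_def id_def)
  next
    case (Suc j)
    then show ?case
      unfolding funpow.simps
      by (intro pullback_compose_invariant[OF pullback_rho_\<omega>] affine_map_rho affine_map_funpow)
  qed
  obtain l j where "g = translate l \<circ> rho ^^ j" using assms(1) unfolding deck_def by blast
  then show ?thesis
    using pullback_compose_invariant[OF pullback_translate_\<omega> rho affine_map_translate
        affine_map_funpow[OF affine_map_rho] assms(2)] by simp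
qed

section \<open>The symplectic orbifold\<close>

lemma invariant_\<omega>: "Mhat.invariant_form 2 \<omega>"
  unfolding Mhat.invariant_form_def using smooth_form_\<omega> pullback_deck_\<omega> by blast

lemma covering_M_atlas: "M.covering_atlas M_atlas"
  unfolding M_atlas_def
proof (rule M.covering_atlas_free)
  fix g p assume "g \<in> lattice_translations" "g p = p"
  then obtain l where "g = translate l" "translate l p = p" by (auto simp: lattice_translations_def)
  then show "g = id" using translate_fixed_point[of l p] translate_0 by auto
qed

lemma covering_Mhat_atlas: "Mhat.covering_atlas Mhat_atlas"
  using Mhat.covering_atlas_full unfolding Mhat.atlas_def Mhat_atlas_def .

text \<open>Closedness and nondegeneracy are pointwise statements about \<open>\<omega>\<close> on \<open>\<real>\<^sup>8\<close>, the same for every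
  atlas; only the compatibility between charts depends on the quotient.\<close>

lemma symplectic_form_\<omega>:
  fixes A :: "(r2 \<times> r6, 'a) chart set"
  assumes "is_pullback id A A 2 (\<lambda>c. \<omega>) (\<lambda>c. \<omega>)"
  shows "symplectic_form A (\<lambda>c. \<omega>)"
  unfolding symplectic_form_def orbifold_form_def closed_form_def
proof (intro conjI ballI allI impI)
  show "is_pullback id A A 2 (\<lambda>c. \<omega>) (\<lambda>c. \<omega>)" by fact
  have "\<exists>vs. length vs = 2 * 4 \<and> wedge_power \<omega> 4 x vs \<noteq> 0" for x
    by (rule exI[of _ "symplectic_frame x"])
       (use \<omega>_nondegenerate in \<open>simp add: symplectic_frame_def Let_def\<close>)
  moreover have "DIM(r2 \<times> r6) = 2 * 4" by simp
  ultimately show "\<exists>n. DIM(r2 \<times> r6) = 2 * n \<and>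
      (\<forall>c\<in>A. \<forall>x\<in>fst c. \<exists>vs. length vs = 2 * n \<and> wedge_power \<omega> n x vs \<noteq> 0)"
    by blast
qed (simp_all add: smooth_form_\<omega> \<omega>_closed)

theorem proposition5:
  shows "symplectic_manifold M_top M_atlas \<omega>_M \<and> Z3_invariant 2 \<omega>_M \<and>
    (\<exists>\<omega>hat. orbifold_form 2 Mhat_atlas \<omega>hat \<and>
       is_pullback proj_Mhat M_atlas Mhat_atlas 2 \<omega>hat \<omega>_M \<and>
       symplectic_orbifold Mhat_top Mhat_atlas \<omega>hat)"
proof -
  note M = M.discrete_smooth_action_axioms covering_M_atlas
  note Mhat = Mhat.discrete_smooth_action_axioms covering_Mhat_atlas
  note \<omega> = Mhat.discrete_smooth_action_axioms invariant_\<omega>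
  have id: "id \<in> deck" by (rule Mhat.id_mem)
  have "is_pullback id M_atlas M_atlas 2 (\<lambda>c. \<omega>) (\<lambda>c. \<omega>)"
    by (rule is_pullback_of_lift[OF M M \<omega> id lattice_translations_subset_deck]) simp
  then have "symplectic_form M_atlas \<omega>_M"
    unfolding \<omega>_M_def by (rule symplectic_form_\<omega>)
  moreover have "smooth_manifold M_top M_atlas"
    using M.orbifold[OF covering_M_atlas] by (auto simp: smooth_manifold_def M_atlas_def)
  moreover have "Z3_invariant 2 \<omega>_M"
    unfolding Z3_invariant_def \<omega>_M_def
    by (rule is_pullback_of_lift[OF M M \<omega> _ lattice_translations_subset_deck])
       (use rho_deck[of 1] proj_M_rho in auto)
  moreover have "is_pullback id Mhat_atlas Mhat_atlas 2 (\<lambda>c. \<omega>) (\<lambda>c. \<omega>)"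
    by (rule is_pullback_of_lift[OF Mhat Mhat \<omega> id subset_refl]) simp
  then have "symplectic_form Mhat_atlas (\<lambda>c. \<omega>)"
    by (rule symplectic_form_\<omega>)
  moreover have "is_pullback proj_Mhat M_atlas Mhat_atlas 2 (\<lambda>c. \<omega>) \<omega>_M"
    unfolding \<omega>_M_def by (rule is_pullback_of_lift[OF M Mhat \<omega> id subset_refl]) simp
  moreover have "orbifold Mhat_top Mhat_atlas"
    by (rule Mhat.orbifold[OF covering_Mhat_atlas])
  ultimately show ?thesis
    unfolding symplectic_manifold_def symplectic_orbifold_def symplectic_form_def by blast
qed

end
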